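(* Let $X \subseteq \mathbb{R}$ be a set of real numbers and let $A \subseteq \mathbb{R}$. Write $A+X=\{a+x : a\in A,\ x\in X\}$. (1) If $A$ is an $\mathsf{N}$ set and $|X| < \mathfrak{t}$, then $A\cup X$ and $A+X$ are $\mathsf{N}$ sets. (2) If $A$ is an $\mathsf{N}_0$ set and $|X| < \mathfrak{h}$, then $A\cup X$ and $A+X$ are $\mathsf{N}_0$ sets. (3) If $A$ is a $\mathsf{D}_\sigma$ (pseudo-Dirichlet) set and $|X| < \mathfrak{h}$, then $A\cup X$ and $A+X$ are $\mathsf{D}_\sigma$ sets. (4) If $A$ is an $\mathsf{A}$ (Arbault) set and $|X| < \mathfrak{s}$, then $A\cup X$ and $A+X$ are $\mathsf{A}$ sets. (5) If $A$ is an $\mathsf{H}_\sigma$ set and $|X| < \mathfrak{s}$, then $A\cup X$ is an $\mathsf{H}_\sigma$ set.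
   Context: Notation: $\omega$ is the set of natural numbers; $[\omega]^\omega$ is the family of infinite subsets of $\omega$; $\omega^\omega$ is the set of functions from $\omega$ to $\omega$; "increasing" means strictly increasing; $\forall^\infty n$ means "for all but finitely many $n$". For $x\in\mathbb{R}$, $[\![x]\!]$ denotes the distance from $x$ to the nearest integer. For $P,Q\subseteq\omega$, $P\subseteq^\star Q$ means that $P\setminus Q$ is finite. Classes of sets. Let $S\subseteq\mathbb{R}$. - $S$ is an $\mathsf{N}$ set if there is a sequence of reals $\langle a_n : n\in\omega\rangle$ with $\sum_{n=0}^\infty a_n=\infty$ such that $\sum_{n=0}^\infty a_n\sin(\pi n x)$ converges absolutely for all $x\in S$. - $S$ is an $\mathsf{N}_0$ set if there is an increasing $f\in\omega^\omega$ such that $\sum_{n=0}^\infty \sin(\pi f(n)x)$ converges absolutely for all $x\in S$. - $S$ is an $\mathsf{A}$ (Arbault) set if there is an increasing $f\in\omega^\omega$ such that $\lim_{n\to\infty}\sin(\pi f(n)x)=0$ for every $x\in S$. - $S$ is a $\mathsf{D}_\sigma$ (pseudo-Dirichlet) set if there are a sequence of reals $\langle\varepsilon_n:n\in\omega\rangle$ converging to $0$ and an increasing $f\in\omega^\omega$ such that for all $x\in S$, $\forall^\infty n\ |\sin(\pi f(n)x)|<\varepsilon_n$. - $S$ is an $\mathsf{H}$ (Hardy) set if there are reals $a\in(0,1)$ and $\varepsilon<1/2$ and an increasing $f\in\omega^\omega$ such that for all $x\in S$ and all $n$, $[\![f(n)x-a]\!]<\varepsilon$. $S$ is an $\mathsf{H}_\sigma$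 set if it is a countable union of $\mathsf{H}$ sets. Cardinal invariants. - $\mathfrak{t}$ is the least size of a family $\{A_\alpha:\alpha<\kappa\}\subseteq[\omega]^\omega$ such that $A_\alpha\subseteq^\star A_\beta$ whenever $\alpha\ge\beta$, and there is no $B\in[\omega]^\omega$ with $B\subseteq^\star A_\alpha$ for all $\alpha<\kappa$. - $\mathfrak{h}$ is the least size of a family $\{\mathcal{A}_\alpha:\alpha<\kappa\}$ with $\mathcal{A}_\alpha\subseteq[\omega]^\omega$ such that for every $Y\in[\omega]^\omega$ and every $\alpha<\kappa$ there is $C\in\mathcal{A}_\alpha$ with $C\subseteq^\star Y$, but there is no $B\in[\omega]^\omega$ such that for every $\alpha<\kappa$ there is $C\in\mathcal{A}_\alpha$ with $B\subseteq^\star C$. - $\mathfrak{s}$ is the least size of a family $\mathcal{A}\subseteq[\omega]^\omega$ such that for every $B\in[\omega]^\omega$ there is $C\in\mathcal{A}$ with both $B\cap C$ and $B\cap(\omega\setminus C)$ infinite. *)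

theory Defs
  imports Complex_Main "HOL-Library.Infinite_Set" "HOL-Library.Countable_Set"
begin

unbundle cardinal_syntax

definition nearest_int_dist :: "real \<Rightarrow> real" where
  "nearest_int_dist x = \<bar>x - of_int (round x)\<bar>"

definition N_set :: "real set \<Rightarrow> bool" where
  "N_set S \<longleftrightarrow> (\<exists>a :: nat \<Rightarrow> real.
     filterlim (\<lambda>N. \<Sum>n<N. a n) at_top sequentially \<and>
     (\<forall>x\<in>S. summable (\<lambda>n. \<bar>a n * sin (pi * real n * x)\<bar>)))"

definition N0_set :: "real set \<Rightarrow> bool" where
  "N0_set S \<longleftrightarrow> (\<exists>f :: nat \<Rightarrow> nat. strict_mono f \<and>
     (\<forall>x\<in>S. summable (\<lambda>n. \<bar>sin (pi * real (f n) * x)\<bar>)))"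

definition Arbault_set :: "real set \<Rightarrow> bool" where
  "Arbault_set S \<longleftrightarrow> (\<exists>f :: nat \<Rightarrow> nat. strict_mono f \<and>
     (\<forall>x\<in>S. (\<lambda>n. sin (pi * real (f n) * x)) \<longlonglongrightarrow> 0))"

definition pseudo_Dirichlet_set :: "real set \<Rightarrow> bool" where
  "pseudo_Dirichlet_set S \<longleftrightarrow> (\<exists>(\<epsilon> :: nat \<Rightarrow> real) (f :: nat \<Rightarrow> nat).
     \<epsilon> \<longlonglongrightarrow> 0 \<and> strict_mono f \<and>
     (\<forall>x\<in>S. \<forall>\<^sub>F n in sequentially. \<bar>sin (pi * real (f n) * x)\<bar> < \<epsilon> n))"

definition Hardy_set :: "real set \<Rightarrow> bool" where
  "Hardy_set S \<longleftrightarrow> (\<exists>(a :: real) (\<epsilon> :: real) (f :: nat \<Rightarrow> nat).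
     0 < a \<and> a < 1 \<and> \<epsilon> < 1 / 2 \<and> strict_mono f \<and>
     (\<forall>x\<in>S. \<forall>n. nearest_int_dist (real (f n) * x - a) < \<epsilon>))"

definition Hardy_sigma_set :: "real set \<Rightarrow> bool" where
  "Hardy_sigma_set S \<longleftrightarrow> (\<exists>\<F>. countable \<F> \<and> (\<forall>T\<in>\<F>. Hardy_set T) \<and> S = \<Union>\<F>)"


definition almost_subset :: "nat set \<Rightarrow> nat set \<Rightarrow> bool" (infix \<open>\<subseteq>\<^sup>*\<close> 50) where
  "P \<subseteq>\<^sup>* Q \<longleftrightarrow> finite (P - Q)"

text \<open>Cardinals are cardinal orders in the sense of \<^const>\<open>Card_order\<close>, compared up to
  isomorphism. A nonempty set of cardinal orders has a least element, unique up to isomorphism.\<close>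

definition least_card :: "'a rel set \<Rightarrow> 'a rel" where
  "least_card R = (SOME r. r \<in> R \<and> (\<forall>r'\<in>R. r \<le>o r'))"

text \<open>A cardinal order \<open>\<kappa>\<close> serves as its own index set: \<open>(\<beta>, \<alpha>) \<in> \<kappa>\<close> says
  \<open>\<beta> \<le> \<alpha> < \<kappa>\<close>. A type of size continuum is large enough to carry the least such \<open>\<kappa>\<close>, since
  a tower can be thinned out to a tower of regular length with pairwise distinct members.\<close>

definition tower_lengths :: "(nat set) rel set" where
  "tower_lengths = {\<kappa>. Card_order \<kappa> \<and> (\<exists>A :: nat set \<Rightarrow> nat set.
     (\<forall>\<alpha>\<in>Field \<kappa>. infinite (A \<alpha>)) \<and>
     (\<forall>\<alpha> \<beta>. (\<beta>, \<alpha>) \<in> \<kappa> \<longrightarrow> A \<alpha> \<subseteq>\<^sup>* A \<beta>) \<and>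
     \<not> (\<exists>B. infinite B \<and> (\<forall>\<alpha>\<in>Field \<kappa>. B \<subseteq>\<^sup>* A \<alpha>)))}"

definition shattering_family :: "nat set set set \<Rightarrow> bool" where
  "shattering_family F \<longleftrightarrow>
     (\<forall>\<A>\<in>F. \<forall>C\<in>\<A>. infinite C) \<and>
     (\<forall>Y. infinite Y \<longrightarrow> (\<forall>\<A>\<in>F. \<exists>C\<in>\<A>. C \<subseteq>\<^sup>* Y)) \<and>
     \<not> (\<exists>B. infinite B \<and> (\<forall>\<A>\<in>F. \<exists>C\<in>\<A>. B \<subseteq>\<^sup>* C))"

definition splitting_family :: "nat set set \<Rightarrow> bool" where
  "splitting_family \<A> \<longleftrightarrow>
     (\<forall>C\<in>\<A>. infinite C) \<and>
     (\<forall>B. infinite B \<longrightarrow> (\<exists>C\<in>\<A>. infinite (B \<inter> C) \<and> infinite (B \<inter> (UNIV - C))))"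

definition cardinal_t :: "(nat set) rel" where
  "cardinal_t = least_card tower_lengths"

definition cardinal_h :: "(nat set set) rel" where
  "cardinal_h = least_card {|F| | F. shattering_family F}"

definition cardinal_s :: "(nat set) rel" where
  "cardinal_s = least_card {|\<A>| | \<A>. splitting_family \<A>}"


lemma least_card:
  assumes "R \<noteq> {}" and "\<And>r. r \<in> R \<Longrightarrow> Card_order r"
  shows "least_card R \<in> R" and "\<And>r. r \<in> R \<Longrightarrow> least_card R \<le>o r"
proof -
  have "\<exists>r. r \<in> R \<and> (\<forall>r'\<in>R. r \<le>o r')"
    using exists_minim_Card_order[of R] assms by blast
  from someI_ex[OF this]
  show "least_card R \<in> R" and "\<And>r. r \<in> R \<Longrightarrow> least_card R \<le>o r"
    by (auto simp: least_card_def)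
qed

lemma infinite_halve:
  assumes "infinite (B :: nat set)"
  obtains C where "C \<subseteq> B" "infinite C" "infinite (B - C)"
proof -
  have "inj (enumerate B)"
    using strict_mono_enumerate[OF assms] by (rule strict_mono_imp_inj_on)
  then have eq: "enumerate B m = enumerate B n \<longleftrightarrow> m = n" for m n by (rule inj_eq)
  define C where "C = range (\<lambda>n. enumerate B (2 * n))"
  have "infinite C" unfolding C_def by (rule range_inj_infinite) (simp add: inj_def eq)
  moreover have "infinite (range (\<lambda>n. enumerate B (2 * n + 1)))"
    by (rule range_inj_infinite) (simp add: inj_def eq)
  moreover have "range (\<lambda>n. enumerate B (2 * n + 1)) \<subseteq> B - C"
  proof
    fix x assume "x \<in> range (\<lambda>n. enumerate B (2 * n + 1))"
    then obtain n where n: "x = enumerate B (2 * n + 1)" by blast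
    have "2 * n + 1 \<noteq> 2 * m" for m by presburger
    then show "x \<in> B - C" unfolding C_def n using enumerate_in_set[OF assms] eq by fastforce
  qed
  moreover have "C \<subseteq> B" unfolding C_def using enumerate_in_set[OF assms] by auto
  ultimately show ?thesis by (intro that) (auto dest: finite_subset)
qed

lemma almost_subset_refl: "P \<subseteq>\<^sup>* P"
  by (simp add: almost_subset_def)

lemma subset_imp_almost_subset: "P \<subseteq> Q \<Longrightarrow> P \<subseteq>\<^sup>* Q"
  by (simp add: almost_subset_def Diff_eq_empty_iff[THEN iffD2])

lemma almost_subset_trans:
  assumes "P \<subseteq>\<^sup>* Q" "Q \<subseteq>\<^sup>* R" shows "P \<subseteq>\<^sup>* R"
proof -
  have "P - R \<subseteq> (P - Q) \<union> (Q - R)" by blast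
  then show ?thesis using assms unfolding almost_subset_def by (meson finite_UnI finite_subset)
qed

lemma splitting_family_ex: "splitting_family {C. infinite C}"
  unfolding splitting_family_def
proof (intro conjI allI impI)
  fix B :: "nat set" assume "infinite B"
  then obtain C where C: "C \<subseteq> B" "infinite C" "infinite (B - C)" by (rule infinite_halve)
  then have "B \<inter> C = C" "B \<inter> (UNIV - C) = B - C" by auto
  with C show "\<exists>C\<in>{C. infinite C}. infinite (B \<inter> C) \<and> infinite (B \<inter> (UNIV - C))"
    by (intro bexI[of _ C]) simp_all
qed simp

lemma shattering_family_ex:
  "shattering_family {\<A>. (\<forall>C\<in>\<A>. infinite C) \<and> (\<forall>Y. infinite Y \<longrightarrow> (\<exists>C\<in>\<A>. C \<subseteq>\<^sup>* Y))}"
  (is "shattering_family ?F")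
  unfolding shattering_family_def
proof (intro conjI)
  show "\<forall>\<A>\<in>?F. \<forall>C\<in>\<A>. infinite C" by simp
  show "\<forall>Y. infinite Y \<longrightarrow> (\<forall>\<A>\<in>?F. \<exists>C\<in>\<A>. C \<subseteq>\<^sup>* Y)" by simp
  show "\<not> (\<exists>B. infinite B \<and> (\<forall>\<A>\<in>?F. \<exists>C\<in>\<A>. B \<subseteq>\<^sup>* C))"
  proof
    assume "\<exists>B. infinite B \<and> (\<forall>\<A>\<in>?F. \<exists>C\<in>\<A>. B \<subseteq>\<^sup>* C)"
    then obtain B where B: "infinite B" "\<forall>\<A>\<in>?F. \<exists>C\<in>\<A>. B \<subseteq>\<^sup>* C" by (elim exE conjE)
    have "\<exists>C. infinite C \<and> \<not> B \<subseteq>\<^sup>* C \<and> C \<subseteq>\<^sup>* Y" if "infinite Y" for Y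
    proof (cases "B \<subseteq>\<^sup>* Y")
      case True
      obtain C where C: "C \<subseteq> B" "infinite C" "infinite (B - C)"
        using B(1) by (rule infinite_halve)
      have "C \<subseteq>\<^sup>* Y" using subset_imp_almost_subset[OF C(1)] True by (rule almost_subset_trans)
      moreover have "\<not> B \<subseteq>\<^sup>* C" using C(3) by (simp add: almost_subset_def)
      ultimately show ?thesis using C(2) by blast
    next
      case False
      with that show ?thesis using almost_subset_refl[of Y] by (intro exI[of _ Y]) simp
    qed
    then have "{C. infinite C \<and> \<not> B \<subseteq>\<^sup>* C} \<in> ?F" by simp
    from bspec[OF B(2) this] show False by simp
  qed
qed

lemma maximal_almost_chain:
  "\<exists>C. (\<forall>c\<in>C. infinite c) \<and> (\<forall>c\<in>C. \<forall>d\<in>C. c \<subseteq>\<^sup>* d \<or> d \<subseteq>\<^sup>* c) \<and>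
     \<not> (\<exists>B. infinite B \<and> (\<forall>c\<in>C. B \<subseteq>\<^sup>* c))"
proof -
  define Z where "Z = {C. (\<forall>c\<in>C. infinite c) \<and> (\<forall>c\<in>C. \<forall>d\<in>C. c \<subseteq>\<^sup>* d \<or> d \<subseteq>\<^sup>* c)}"
  have "\<Union>K \<in> Z" if "subset.chain Z K" for K
  proof -
    have KZ: "K \<subseteq> Z" and tot: "\<And>C D. C \<in> K \<Longrightarrow> D \<in> K \<Longrightarrow> C \<subseteq> D \<or> D \<subseteq> C"
      using that by (auto simp: subset_chain_def)
    have "c \<subseteq>\<^sup>* d \<or> d \<subseteq>\<^sup>* c" if "C \<in> K" "c \<in> C" "D \<in> K" "d \<in> D" for c d C D
      using tot[of C D] that KZ unfolding Z_def by blast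
    then show ?thesis using KZ unfolding Z_def by blast
  qed
  then obtain C where C: "C \<in> Z" and max: "\<And>D. D \<in> Z \<Longrightarrow> C \<subseteq> D \<Longrightarrow> D = C"
    using subset_Zorn'[of Z] by metis
  have "\<not> (\<exists>B. infinite B \<and> (\<forall>c\<in>C. B \<subseteq>\<^sup>* c))"
  proof
    assume "\<exists>B. infinite B \<and> (\<forall>c\<in>C. B \<subseteq>\<^sup>* c)"
    then obtain B where B: "infinite B" "\<forall>c\<in>C. B \<subseteq>\<^sup>* c" by blast
    obtain D where D: "D \<subseteq> B" "infinite D" "infinite (B - D)"
      using B(1) by (rule infinite_halve)
    have "D \<subseteq>\<^sup>* c" if "c \<in> C" for c
      using B(2) that D(1) almost_subset_trans subset_imp_almost_subset by blast
    then have "insert D C \<in> Z"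
      using C D(2) almost_subset_refl unfolding Z_def by auto
    with max have "D \<in> C" by blast
    with B(2) D(3) show False by (auto simp: almost_subset_def)
  qed
  with C show ?thesis unfolding Z_def by (intro exI[of _ C]) simp
qed

lemma tower_lengths_nonempty: "tower_lengths \<noteq> {}"
proof -
  obtain C :: "nat set set" where inf: "\<And>c. c \<in> C \<Longrightarrow> infinite c"
    and chain: "\<And>c d. c \<in> C \<Longrightarrow> d \<in> C \<Longrightarrow> c \<subseteq>\<^sup>* d \<or> d \<subseteq>\<^sup>* c"
    and nopi: "\<not> (\<exists>B. infinite B \<and> (\<forall>c\<in>C. B \<subseteq>\<^sup>* c))"
    using maximal_almost_chain by metis
  define coinit where "coinit D \<longleftrightarrow> D \<subseteq> C \<and> (\<forall>c\<in>C. \<exists>d\<in>D. d \<subseteq>\<^sup>* c)" for D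
  have "coinit C" unfolding coinit_def using almost_subset_refl by blast
  then have ne: "{|D| | D. coinit D} \<noteq> {}" by blast
  have co: "\<forall>r\<in>{|D| | D. coinit D}. Card_order r" by (auto simp: card_of_Card_order)
  obtain D where D: "coinit D" and Dmin: "\<And>E. coinit E \<Longrightarrow> |D| \<le>o |E|"
    using exists_minim_Card_order[OF ne co] by blast
  define S where "S = {c \<in> D. \<forall>d\<in>D. (d, c) \<in> |D| \<and> d \<noteq> c \<longrightarrow> c \<subseteq>\<^sup>* d}"
  have wo: "Well_order |D|" and fld: "Field |D| = D"
    by (rule card_of_Well_order Field_card_of)+
  have SD: "S \<subseteq> D" unfolding S_def by blast
  have DC: "D \<subseteq> C" using D unfolding coinit_def by blast
  have "coinit S"
    unfolding coinit_def
  proof (intro conjI ballI)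
    show "S \<subseteq> C" using SD DC by blast
    fix c assume c: "c \<in> C"
    define W where "W = {d \<in> D. d \<subseteq>\<^sup>* c}"
    have "W \<noteq> {}" using D c unfolding coinit_def W_def by blast
    moreover have "W \<subseteq> Field |D|" unfolding W_def fld by blast
    ultimately obtain d where d: "d \<in> W" and dmin: "\<And>e. e \<in> W \<Longrightarrow> (d, e) \<in> |D|"
      using wo_rel.minim_in[of "|D|" W] wo_rel.minim_least[of "|D|" W] wo
      unfolding wo_rel_def by metis
    have anti: "antisym |D|" using wo by (simp add: order_on_defs)
    have "d \<subseteq>\<^sup>* e" if e: "e \<in> D" "(e, d) \<in> |D|" "e \<noteq> d" for e
    proof -
      have "e \<notin> W" using dmin e anti by (meson antisymD)
      then have "\<not> e \<subseteq>\<^sup>* c" using e unfolding W_def by blast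
      then have "c \<subseteq>\<^sup>* e" using chain[of c e] c e DC by blast
      then show ?thesis using d almost_subset_trans unfolding W_def by blast
    qed
    then show "\<exists>d\<in>S. d \<subseteq>\<^sup>* c" using d unfolding S_def W_def by blast
  qed
  define r where "r = Restr |D| S"
  have wor: "Well_order r" unfolding r_def using wo by (rule Well_order_Restr)
  have "Refl |D|" using wo by (simp add: order_on_defs)
  then have fr: "Field r = S" unfolding r_def using SD fld by (simp add: Refl_Field_Restr2)
  have "Restr r (underS r a) <o |Field r|" if a: "a \<in> Field r" for a
  proof (rule ccontr)
    let ?r' = "Restr r (underS r a)"
    assume "\<not> ?r' <o |Field r|"
    then have "|S| \<le>o ?r'"
      using not_ordLess_iff_ordLeq Well_order_Restr[OF wor] card_of_Well_order unfolding fr by blast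
    from card_of_mono2[OF this] have "|S| \<le>o |Field ?r'|" by (simp add: Field_card_of)
    also have "|Field ?r'| \<le>o |underS |D| a|"
      using Field_Restr_subset[of r "underS r a"]
      by (intro card_of_mono1) (auto simp: underS_def r_def)
    also have "|underS |D| a| <o |D|"
      using a fr SD fld card_of_Card_order[of D] by (intro card_of_underS) auto
    also have "|D| \<le>o |S|" using Dmin \<open>coinit S\<close> .
    finally show False using ordLess_irreflexive by blast
  qed
  then have "Card_order r" using Card_order_iff_Restr_underS[OF wor] by blast
  moreover have "\<forall>\<alpha>\<in>Field r. infinite (id \<alpha>)" using fr SD DC inf by auto
  moreover have "\<forall>\<alpha> \<beta>. (\<beta>, \<alpha>) \<in> r \<longrightarrow> id \<alpha> \<subseteq>\<^sup>* id \<beta>"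
    unfolding r_def S_def using almost_subset_refl by auto
  moreover have "\<not> (\<exists>B. infinite B \<and> (\<forall>\<alpha>\<in>Field r. B \<subseteq>\<^sup>* id \<alpha>))"
    using nopi \<open>coinit S\<close> almost_subset_trans unfolding fr coinit_def id_def by meson
  ultimately have "r \<in> tower_lengths" unfolding tower_lengths_def by blast
  then show ?thesis by blast
qed

lemma cardinal_t_least:
  "cardinal_t \<in> tower_lengths" "\<And>r. r \<in> tower_lengths \<Longrightarrow> cardinal_t \<le>o r"
proof -
  have "\<And>r. r \<in> tower_lengths \<Longrightarrow> Card_order r" unfolding tower_lengths_def by blast
  note least = least_card[OF tower_lengths_nonempty this, folded cardinal_t_def]
  show "cardinal_t \<in> tower_lengths" by (rule least(1))
  show "\<And>r. r \<in> tower_lengths \<Longrightarrow> cardinal_t \<le>o r" by (rule least(2))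
qed

lemma cardinal_h_least:
  "\<exists>F. shattering_family F \<and> cardinal_h = |F|" "\<And>F. shattering_family F \<Longrightarrow> cardinal_h \<le>o |F|"
proof -
  have ne: "{|F| | F. shattering_family F} \<noteq> {}" using shattering_family_ex by blast
  have co: "\<And>r. r \<in> {|F| | F. shattering_family F} \<Longrightarrow> Card_order r"
    using card_of_Card_order by blast
  note least = least_card[OF ne co, folded cardinal_h_def]
  show "\<exists>F. shattering_family F \<and> cardinal_h = |F|" using least(1) by blast
  show "\<And>F. shattering_family F \<Longrightarrow> cardinal_h \<le>o |F|" using least(2) by blast
qed

lemma cardinal_s_least:
  "\<exists>\<A>. splitting_family \<A> \<and> cardinal_s = |\<A>|" "\<And>\<A>. splitting_family \<A> \<Longrightarrow> cardinal_s \<le>o |\<A>|"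
proof -
  have ne: "{|\<A>| | \<A>. splitting_family \<A>} \<noteq> {}" using splitting_family_ex by blast
  have co: "\<And>r. r \<in> {|\<A>| | \<A>. splitting_family \<A>} \<Longrightarrow> Card_order r"
    using card_of_Card_order by blast
  note least = least_card[OF ne co, folded cardinal_s_def]
  show "\<exists>\<A>. splitting_family \<A> \<and> cardinal_s = |\<A>|" using least(1) by blast
  show "\<And>\<A>. splitting_family \<A> \<Longrightarrow> cardinal_s \<le>o |\<A>|" using least(2) by blast
qed

end

theory Submission
  imports Defs
begin

text \<open>Since \<open>\<bar>sin (u + v)\<bar> \<le> \<bar>sin u\<bar> + \<bar>sin v\<bar>\<close>, a sequence witnessing the smallness of \<open>A \<union> X\<close> also
  witnesses that of \<open>A + X\<close>, so only unions matter. Except for N sets, the new frequencies are the differences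
  \<open>f (b (n + 1)) - f (b n)\<close> of frequencies that work for \<open>A\<close>: the triangle inequality keeps them good for
  \<open>A\<close>, and they are good for \<open>x \<in> X\<close> as soon as \<open>f (b n) x\<close> converges modulo 1. Below \<^const>\<open>cardinal_s\<close> one can make
  all these sequences converge simultaneously, and below \<^const>\<open>cardinal_h\<close> even geometrically fast. An Arbault set is
  \<open>H\<^sub>\<sigma>\<close> with centre \<open>1/4\<close>, because \<open>[[f(n) x]] < 1/8\<close> gives \<open>[[f(n) x - 1/4]] < 3/8\<close>.

  For N sets, cut the weights \<open>a n\<close> into finite blocks of rapidly growing weight. A point \<open>x\<close> is handled
  by keeping in block \<open>j\<close> the heaviest of the \<open>2 ^ j\<close> classes of frequencies \<open>n\<close> on which \<open>n x\<close> is
  constant modulo 1 up to \<open>2 ^ -j\<close>. A recursion of length less than \<^const>\<open>cardinal_t\<close> treats all points of \<open>X\<close>,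
  and the new weights live on the differences of two frequencies from the same block.\<close>

subsection \<open>Sine bounds and sumsets\<close>

lemma abs_sin_add_le: "\<bar>sin (a + b)\<bar> \<le> \<bar>sin a\<bar> + \<bar>sin b\<bar>" for a b :: real
proof -
  have "\<bar>sin (a + b)\<bar> \<le> \<bar>sin a * cos b\<bar> + \<bar>cos a * sin b\<bar>"
    by (simp add: sin_add)
  also have "\<dots> \<le> \<bar>sin a\<bar> + \<bar>sin b\<bar>"
    by (intro add_mono) (auto simp: abs_mult intro: mult_left_le mult_left_le_one_le)
  finally show ?thesis .
qed

lemma abs_sin_diff_le: "\<bar>sin (a - b)\<bar> \<le> \<bar>sin a\<bar> + \<bar>sin b\<bar>" for a b :: real
  using abs_sin_add_le[of a "- b"] by simp

lemma abs_sin_freq_add_le: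
  "\<bar>sin (pi * real n * (a + x))\<bar> \<le> \<bar>sin (pi * real n * a)\<bar> + \<bar>sin (pi * real n * x)\<bar>"
  using abs_sin_add_le[of "pi * real n * a" "pi * real n * x"] by (simp add: distrib_left)

lemma abs_sin_freq_diff_le:
  assumes "m \<le> n"
  shows "\<bar>sin (pi * real (n - m) * x)\<bar> \<le> \<bar>sin (pi * real n * x)\<bar> + \<bar>sin (pi * real m * x)\<bar>"
proof -
  have "pi * real (n - m) * x = pi * real n * x - pi * real m * x"
    using assms by (simp add: of_nat_diff left_diff_distrib right_diff_distrib)
  then show ?thesis by (simp only: abs_sin_diff_le)
qed

lemma abs_sin_pi_add_of_int: "\<bar>sin (pi * (t + of_int m))\<bar> = \<bar>sin (pi * t)\<bar>"
  by (simp add: distrib_left sin_add sin_npi_int cos_npi_int abs_mult)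

lemma N_set_sumset:
  assumes "N_set (A \<union> X)" shows "N_set {a + x | a x. a \<in> A \<and> x \<in> X}"
proof -
  obtain w :: "nat \<Rightarrow> real" where w: "filterlim (\<lambda>N. \<Sum>n<N. w n) at_top sequentially"
    and s: "\<And>x. x \<in> A \<union> X \<Longrightarrow> summable (\<lambda>n. \<bar>w n * sin (pi * real n * x)\<bar>)"
    using assms by (auto simp: N_set_def)
  have "summable (\<lambda>n. \<bar>w n * sin (pi * real n * (a + x))\<bar>)" if "a \<in> A" "x \<in> X" for a x
  proof (rule summable_comparison_test')
    show "summable (\<lambda>n. \<bar>w n * sin (pi * real n * a)\<bar> + \<bar>w n * sin (pi * real n * x)\<bar>)"
      using that by (intro summable_add s) auto
    show "norm \<bar>w n * sin (pi * real n * (a + x))\<bar>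
        \<le> \<bar>w n * sin (pi * real n * a)\<bar> + \<bar>w n * sin (pi * real n * x)\<bar>" if "n \<ge> 0" for n
      using mult_left_mono[OF abs_sin_freq_add_le[of n a x] abs_ge_zero[of "w n"]]
      by (simp add: abs_mult distrib_left)
  qed
  with w show ?thesis unfolding N_set_def by (intro exI[of _ w]) auto
qed

lemma N0_set_sumset:
  assumes "N0_set (A \<union> X)" shows "N0_set {a + x | a x. a \<in> A \<and> x \<in> X}"
proof -
  obtain f :: "nat \<Rightarrow> nat" where f: "strict_mono f"
    and s: "\<And>x. x \<in> A \<union> X \<Longrightarrow> summable (\<lambda>n. \<bar>sin (pi * real (f n) * x)\<bar>)"
    using assms by (auto simp: N0_set_def)
  have "summable (\<lambda>n. \<bar>sin (pi * real (f n) * (a + x))\<bar>)" if "a \<in> A" "x \<in> X" for a x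
  proof (rule summable_comparison_test')
    show "summable (\<lambda>n. \<bar>sin (pi * real (f n) * a)\<bar> + \<bar>sin (pi * real (f n) * x)\<bar>)"
      using that by (intro summable_add s) auto
    show "norm \<bar>sin (pi * real (f n) * (a + x))\<bar>
        \<le> \<bar>sin (pi * real (f n) * a)\<bar> + \<bar>sin (pi * real (f n) * x)\<bar>" for n
      using abs_sin_freq_add_le[of "f n" a x] by simp
  qed
  with f show ?thesis unfolding N0_set_def by (intro exI[of _ f]) auto
qed

lemma Arbault_set_sumset:
  assumes "Arbault_set (A \<union> X)" shows "Arbault_set {a + x | a x. a \<in> A \<and> x \<in> X}"
proof -
  obtain f :: "nat \<Rightarrow> nat" where f: "strict_mono f"
    and s: "\<And>x. x \<in> A \<union> X \<Longrightarrow> (\<lambda>n. sin (pi * real (f n) * x)) \<longlonglongrightarrow> 0"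
    using assms by (auto simp: Arbault_set_def)
  have "(\<lambda>n. sin (pi * real (f n) * (a + x))) \<longlonglongrightarrow> 0" if "a \<in> A" "x \<in> X" for a x
  proof (rule tendsto_0_le[where K = 1])
    show "(\<lambda>n. \<bar>sin (pi * real (f n) * a)\<bar> + \<bar>sin (pi * real (f n) * x)\<bar>) \<longlonglongrightarrow> 0"
      using that by (intro tendsto_add_zero tendsto_rabs_zero s) blast+
    show "\<forall>\<^sub>F n in sequentially. norm (sin (pi * real (f n) * (a + x)))
        \<le> norm (\<bar>sin (pi * real (f n) * a)\<bar> + \<bar>sin (pi * real (f n) * x)\<bar>) * 1"
      using order.trans[OF abs_sin_freq_add_le abs_ge_self]
      by (intro always_eventually allI) (simp only: real_norm_def mult_1_right)
  qed
  with f show ?thesis unfolding Arbault_set_def by (intro exI[of _ f]) auto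
qed

lemma pseudo_Dirichlet_set_sumset:
  assumes "pseudo_Dirichlet_set (A \<union> X)"
  shows "pseudo_Dirichlet_set {a + x | a x. a \<in> A \<and> x \<in> X}"
proof -
  obtain e :: "nat \<Rightarrow> real" and f :: "nat \<Rightarrow> nat" where e: "e \<longlonglongrightarrow> 0" and f: "strict_mono f"
    and s: "\<And>x. x \<in> A \<union> X \<Longrightarrow> \<forall>\<^sub>F n in sequentially. \<bar>sin (pi * real (f n) * x)\<bar> < e n"
    using assms by (auto simp: pseudo_Dirichlet_set_def)
  have "\<forall>\<^sub>F n in sequentially. \<bar>sin (pi * real (f n) * (a + x))\<bar> < e n + e n"
    if "a \<in> A" "x \<in> X" for a x
  proof -
    have "\<forall>\<^sub>F n in sequentially. \<bar>sin (pi * real (f n) * a)\<bar> < e n"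
      "\<forall>\<^sub>F n in sequentially. \<bar>sin (pi * real (f n) * x)\<bar> < e n"
      using that s by auto
    then show ?thesis
      by eventually_elim (rule order.strict_trans1[OF abs_sin_freq_add_le add_strict_mono])
  qed
  moreover have "(\<lambda>n. e n + e n) \<longlonglongrightarrow> 0" using e by (intro tendsto_add_zero)
  ultimately show ?thesis
    unfolding pseudo_Dirichlet_set_def using f
    by (intro exI[of _ "\<lambda>n. e n + e n"] exI[of _ f]) auto
qed

subsection \<open>Arbault and Hardy sets\<close>

text \<open>Differences of increasing frequencies need not increase. Once the frequencies more than
  double at each step, the next difference exceeds \<open>f (r (Suc n))\<close>, which already
  bounds the current one.\<close>

lemma strict_mono_sparse_differences:
  fixes f :: "nat \<Rightarrow> nat"
  assumes "strict_mono f"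
  obtains r where "strict_mono r" "strict_mono (\<lambda>n. f (r (Suc n)) - f (r n))"
proof -
  have "\<exists>m. True \<and> n < m \<and> 2 * f n < f m" for n
  proof (intro exI conjI)
    show "n < Suc (2 * f n)" "2 * f n < f (Suc (2 * f n))"
      using strict_mono_imp_increasing[OF assms, of n]
        strict_mono_imp_increasing[OF assms, of "Suc (2 * f n)"] by linarith+
  qed simp
  then obtain r where r: "\<And>n. r n < r (Suc n)" "\<And>n. 2 * f (r n) < f (r (Suc n))"
    using dependent_nat_choice[of "\<lambda>_ _. True" "\<lambda>_ n m. n < m \<and> 2 * f n < f m"] by blast
  have "strict_mono r" using r(1) by (simp add: strict_mono_Suc_iff)
  moreover have "f (r (Suc n)) - f (r n) < f (r (Suc (Suc n))) - f (r (Suc n))" for n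
    using r(2)[of n] r(2)[of "Suc n"] by linarith
  then have "strict_mono (\<lambda>n. f (r (Suc n)) - f (r n))" by (simp add: strict_mono_Suc_iff)
  ultimately show ?thesis by (rule that)
qed

section \<open>Simultaneous convergence of fewer than \<open>cardinal_s\<close> sequences\<close>

lemma bounded_real_convergent_subseq:
  fixes v :: "nat \<Rightarrow> real"
  assumes "\<And>n. \<bar>v n\<bar> \<le> M"
  obtains r where "strict_mono r" "convergent (v \<circ> r)"
proof -
  obtain r where r: "strict_mono r" "monoseq (v \<circ> r)"
    using seq_monosub[of v] by (auto simp: o_def)
  have "Bseq (v \<circ> r)" using assms by (intro BseqI'[of _ M]) simp
  with r show ?thesis using Bseq_monoseq_convergent that by blast
qed

text \<open>For infinite \<open>I\<close> the rational thresholds yield at most \<open>|I|\<close>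
  sets, too few to split every infinite set. This absorption fails for finite \<open>I\<close>,
  where convergent subsequences are extracted one after another instead.\<close>

lemma less_cardinal_s_convergent_subseq:
  fixes u :: "'i \<Rightarrow> nat \<Rightarrow> real"
  assumes I: "|I| <o cardinal_s" and bd: "\<And>i n. i \<in> I \<Longrightarrow> \<bar>u i n\<bar> \<le> M"
  obtains h where "strict_mono h" "\<And>i. i \<in> I \<Longrightarrow> convergent (u i \<circ> h)"
proof (cases "finite I")
  case True
  then have "\<exists>h. strict_mono h \<and> (\<forall>i\<in>I. convergent (u i \<circ> h))" using bd
  proof (induction I)
    case empty
    show ?case by (intro exI[of _ id]) (simp add: strict_mono_def)
  next
    case (insert i I)
    then obtain h where h: "strict_mono h" "\<And>i. i \<in> I \<Longrightarrow> convergent (u i \<circ> h)" by blast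
    have "\<And>n. \<bar>(u i \<circ> h) n\<bar> \<le> M" using insert.prems by simp
    then obtain r where r: "strict_mono r" "convergent ((u i \<circ> h) \<circ> r)"
      by (rule bounded_real_convergent_subseq)
    have "convergent (u j \<circ> (h \<circ> r))" if "j \<in> I" for j
      using convergent_subseq_convergent[OF h(2)[OF that] r(1)] by (simp add: o_assoc)
    moreover have "convergent (u i \<circ> (h \<circ> r))" using r(2) by (simp only: o_assoc)
    moreover have "strict_mono (h \<circ> r)" using h(1) r(1) by (rule strict_mono_o)
    ultimately show ?case by blast
  qed
  with that show ?thesis by blast
next
  case False
  \<comment> \<open>A set unsplit by every \<open>{n. u i n < q}\<close> with \<open>q\<close> rational carries a subsequence along which each
    \<open>u i\<close> has a single cluster point.\<close>
  define C where "C = (\<lambda>(i, q). {n. u i n < of_rat q})"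
  \<comment> \<open>A splitting family has only infinite members, so finite sets
    \<open>C (i, q)\<close> are dropped here; \<open>dec\<close> treats them separately.\<close>
  define \<A> where "\<A> = {S \<in> C ` (I \<times> UNIV). infinite S}"
  have "|\<A>| \<le>o |C ` (I \<times> UNIV)|" unfolding \<A>_def by (intro card_of_mono1) auto
  also have "|C ` (I \<times> UNIV)| \<le>o |I \<times> (UNIV :: rat set)|" by (rule card_of_image)
  also have "|I \<times> (UNIV :: rat set)| \<le>o |I|"
  proof -
    have "|UNIV :: rat set| \<le>o |UNIV :: nat set|"
      by (rule card_of_ordLeqI[of to_nat]) auto
    also have "|UNIV :: nat set| \<le>o |I|" using False by (simp add: infinite_iff_card_of_nat)
    finally show ?thesis
      by (rule ordIso_imp_ordLeq[OF card_of_Times_infinite_simps(1)[OF False UNIV_not_empty]])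
  qed
  also note I
  finally have "\<not> splitting_family \<A>"
    using cardinal_s_least(2) not_ordLess_ordLeq by blast
  then obtain B where B: "infinite B"
    "\<And>S. S \<in> \<A> \<Longrightarrow> finite (B \<inter> S) \<or> finite (B \<inter> (UNIV - S))"
    unfolding splitting_family_def \<A>_def by auto
  define h where "h = enumerate B"
  have h: "strict_mono h" "\<And>n. h n \<in> B"
    using B(1) unfolding h_def by (auto intro: strict_mono_enumerate enumerate_in_set)
  have ev: "(\<forall>\<^sub>F n in sequentially. h n \<notin> S)" if "finite (B \<inter> S)" for S
  proof -
    have "finite (h -` (B \<inter> S))"
      using that h(1) by (intro finite_vimageI) (auto intro: strict_mono_imp_inj_on)
    moreover have "h -` (B \<inter> S) = {n. h n \<in> S}" using h(2) by auto
    ultimately show ?thesis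
      by (simp add: cofinite_eq_sequentially[symmetric] eventually_cofinite)
  qed
  have dec: "(\<forall>\<^sub>F n in sequentially. u i (h n) < of_rat q) \<or>
      (\<forall>\<^sub>F n in sequentially. \<not> u i (h n) < of_rat q)" if "i \<in> I" for i q
  proof (cases "finite (C (i, q))")
    case True
    then show ?thesis using ev[of "C (i, q)"] by (simp add: C_def)
  next
    case False
    with that have "C (i, q) \<in> \<A>" unfolding \<A>_def by blast
    then show ?thesis using B(2)[of "C (i, q)"] ev[of "C (i, q)"] ev[of "UNIV - C (i, q)"]
      by (auto simp: C_def)
  qed
  have "convergent (u i \<circ> h)" if i: "i \<in> I" for i
  proof -
    have "\<And>n. \<bar>(u i \<circ> h) n\<bar> \<le> M" using bd i by simp
    then obtain r where r: "strict_mono r" "convergent ((u i \<circ> h) \<circ> r)"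
      by (rule bounded_real_convergent_subseq)
    then obtain l where l: "((u i \<circ> h) \<circ> r) \<longlonglongrightarrow> l" unfolding convergent_def by blast
    have sub: "\<forall>\<^sub>F n in sequentially. P (r n)" if "\<forall>\<^sub>F n in sequentially. P n" for P
      using eventually_subseq[OF r(1) that] .
    \<comment> \<open>One subsequential limit determines the limit: \<open>dec\<close> settles every
      rational threshold along all of \<open>h\<close>, and the subsequence \<open>r\<close> rules
      out the wrong side.\<close>
    have "(u i \<circ> h) \<longlonglongrightarrow> l"
    proof (rule order_tendstoI)
      fix a assume "a < l"
      then obtain q where q: "a < of_rat q" "of_rat q < l" using of_rat_dense by blast
      have "\<forall>\<^sub>F n in sequentially. of_rat q < ((u i \<circ> h) \<circ> r) n"
        using order_tendstoD(1)[OF l q(2)] .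
      then have "\<not> (\<forall>\<^sub>F n in sequentially. u i (h (r n)) < of_rat q)"
        using eventually_happens[OF eventually_conj] by (fastforce simp: trivial_limit_sequentially)
      then have "\<forall>\<^sub>F n in sequentially. \<not> u i (h n) < of_rat q"
        using dec[OF i, of q] sub by blast
      then show "\<forall>\<^sub>F n in sequentially. a < (u i \<circ> h) n"
        by eventually_elim (use q in auto)
    next
      fix a assume "l < a"
      then obtain q where q: "l < of_rat q" "of_rat q < a" using of_rat_dense by blast
      have "\<forall>\<^sub>F n in sequentially. ((u i \<circ> h) \<circ> r) n < of_rat q"
        using order_tendstoD(2)[OF l q(1)] .
      then have "\<not> (\<forall>\<^sub>F n in sequentially. \<not> u i (h (r n)) < of_rat q)"
        using eventually_happens[OF eventually_conj] by (fastforce simp: trivial_limit_sequentially)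
      then have "\<forall>\<^sub>F n in sequentially. u i (h n) < of_rat q"
        using dec[OF i, of q] sub by blast
      then show "\<forall>\<^sub>F n in sequentially. (u i \<circ> h) n < a"
        by eventually_elim (use q in auto)
    qed
    then show ?thesis unfolding convergent_def by blast
  qed
  with h(1) that show ?thesis by blast
qed

text \<open>This rests on \<open>4 sin\<^sup>2 ((v - u) / 2) = (cos v - cos u)\<^sup>2 + (sin v - sin u)\<^sup>2\<close>.\<close>

lemma sin_differences_small:
  fixes c s :: "nat \<Rightarrow> real"
  assumes c: "c = (\<lambda>n. cos (2 * pi * real (f n) * x))" and s: "s = (\<lambda>n. sin (2 * pi * real (f n) * x))"
    and conv: "convergent c" "convergent s" and f: "mono f" and e: "e > 0"
  obtains N where "\<And>i j. N \<le> i \<Longrightarrow> i \<le> j \<Longrightarrow> \<bar>sin (pi * real (f j - f i) * x)\<bar> < e"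
proof -
  have sq: "(sin (pi * real (f j - f i) * x))\<^sup>2 = ((c j - c i)\<^sup>2 + (s j - s i)\<^sup>2) / 4"
    if "i \<le> j" for i j
  proof -
    let ?u = "2 * pi * real (f j) * x" and ?v = "2 * pi * real (f i) * x"
    have "2 * (pi * real (f j - f i) * x) = ?u - ?v"
      using monoD[OF f that] by (simp add: of_nat_diff algebra_simps)
    then have "cos (?u - ?v) = 1 - 2 * (sin (pi * real (f j - f i) * x))\<^sup>2"
      using cos_double_sin[of "pi * real (f j - f i) * x"] by simp
    then have "2 * (sin (pi * real (f j - f i) * x))\<^sup>2 = 1 - (c j * c i + s j * s i)"
      unfolding c s cos_diff by simp
    moreover have "(c j)\<^sup>2 + (s j)\<^sup>2 = 1" "(c i)\<^sup>2 + (s i)\<^sup>2 = 1" unfolding c s by simp_all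
    ultimately show ?thesis by (simp add: power2_diff algebra_simps)
  qed
  have "Cauchy c" "Cauchy s" using conv by (simp_all add: Cauchy_convergent_iff)
  then obtain M N where M: "\<And>i j. i \<ge> M \<Longrightarrow> j \<ge> M \<Longrightarrow> \<bar>c j - c i\<bar> < e"
    and N: "\<And>i j. i \<ge> N \<Longrightarrow> j \<ge> N \<Longrightarrow> \<bar>s j - s i\<bar> < e"
    using e by (metis Cauchy_iff real_norm_def)
  have "\<bar>sin (pi * real (f j - f i) * x)\<bar> < e" if "max M N \<le> i" "i \<le> j" for i j
  proof (rule power2_less_imp_less)
    have "\<bar>c j - c i\<bar>\<^sup>2 < e\<^sup>2" "\<bar>s j - s i\<bar>\<^sup>2 < e\<^sup>2"
      using that by (intro power_strict_mono M N; simp)+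
    then have "(c j - c i)\<^sup>2 + (s j - s i)\<^sup>2 < 4 * e\<^sup>2"
      using zero_le_power2[of e] unfolding power2_abs by linarith
    then show "\<bar>sin (pi * real (f j - f i) * x)\<bar>\<^sup>2 < e\<^sup>2"
      using sq[OF that(2)] by simp
  qed (use e in simp)
  then show ?thesis by (rule that)
qed

text \<open>Convergence of \<open>f n * x\<close> modulo 1 is expressed by the cosine and sine of
  \<open>2 * pi * f n * x\<close>, two bounded real sequences, so two successive extractions are
  made. The bound concerns all late pairs \<open>i \<le> j\<close> and therefore survives further
  thinning of \<open>b\<close>.\<close>

lemma less_cardinal_s_small_differences:
  fixes f :: "nat \<Rightarrow> nat"
  assumes X: "|X| <o cardinal_s" and f: "strict_mono f"
  obtains b :: "nat \<Rightarrow> nat" where "strict_mono b"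
    "\<And>x e. x \<in> X \<Longrightarrow> e > 0 \<Longrightarrow> \<exists>N. \<forall>i\<ge>N. \<forall>j\<ge>i. \<bar>sin (pi * real (f (b j) - f (b i)) * x)\<bar> < e"
proof -
  obtain h where h: "strict_mono h"
    "\<And>x. x \<in> X \<Longrightarrow> convergent ((\<lambda>n. cos (2 * pi * real (f n) * x)) \<circ> h)"
    using less_cardinal_s_convergent_subseq[OF X, of "\<lambda>x n. cos (2 * pi * real (f n) * x)" 1]
    by auto
  obtain r where r: "strict_mono r"
    "\<And>x. x \<in> X \<Longrightarrow> convergent ((\<lambda>n. sin (2 * pi * real (f (h n)) * x)) \<circ> r)"
    using less_cardinal_s_convergent_subseq[OF X, of "\<lambda>x n. sin (2 * pi * real (f (h n)) * x)" 1]
    by auto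
  have "\<exists>N. \<forall>i\<ge>N. \<forall>j\<ge>i. \<bar>sin (pi * real (f ((h \<circ> r) j) - f ((h \<circ> r) i)) * x)\<bar> < e"
    if "x \<in> X" "e > 0" for x e
  proof -
    have "convergent (\<lambda>n. cos (2 * pi * real ((f \<circ> h \<circ> r) n) * x))"
      "convergent (\<lambda>n. sin (2 * pi * real ((f \<circ> h \<circ> r) n) * x))"
      using convergent_subseq_convergent[OF h(2)[OF that(1)] r(1)] r(2)[OF that(1)]
      by (simp_all add: o_def)
    moreover have "mono (f \<circ> h \<circ> r)" using f h(1) r(1)
      by (intro strict_mono_mono strict_mono_o)
    ultimately show ?thesis
      using sin_differences_small[OF refl refl _ _ _ that(2), of "f \<circ> h \<circ> r" x] by (metis comp_apply)
  qed
  moreover have "strict_mono (h \<circ> r)" using h(1) r(1) by (intro strict_mono_o)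
  ultimately show ?thesis using that by blast
qed

lemma Arbault_set_Un:
  assumes A: "Arbault_set A" and X: "|X| <o cardinal_s"
  shows "Arbault_set (A \<union> X)"
proof -
  obtain f :: "nat \<Rightarrow> nat" where f: "strict_mono f"
    and lim: "\<And>x. x \<in> A \<Longrightarrow> (\<lambda>n. sin (pi * real (f n) * x)) \<longlonglongrightarrow> 0"
    using A by (auto simp: Arbault_set_def)
  obtain h :: "nat \<Rightarrow> nat" where h: "strict_mono h"
    "\<And>x e. x \<in> X \<Longrightarrow> e > 0 \<Longrightarrow> \<exists>N. \<forall>i\<ge>N. \<forall>j\<ge>i. \<bar>sin (pi * real (f (h j) - f (h i)) * x)\<bar> < e"
    using less_cardinal_s_small_differences[OF X f] by blast
  have "strict_mono (f \<circ> h)" using f h(1) by (intro strict_mono_o)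
  then obtain r where r: "strict_mono r" "strict_mono (\<lambda>n. (f \<circ> h) (r (Suc n)) - (f \<circ> h) (r n))"
    by (rule strict_mono_sparse_differences)
  define b where "b = h \<circ> r"
  define g where "g n = f (b (Suc n)) - f (b n)" for n
  have b: "strict_mono b" unfolding b_def using h(1) r(1) by (intro strict_mono_o)
  have g: "strict_mono g" using r(2) unfolding g_def b_def by simp
  have "(\<lambda>n. sin (pi * real (g n) * x)) \<longlonglongrightarrow> 0" if "x \<in> A" for x
  proof (rule tendsto_0_le[where K = 1])
    have "(\<lambda>n. sin (pi * real (f (b n)) * x)) \<longlonglongrightarrow> 0"
      using LIMSEQ_subseq_LIMSEQ[OF lim[OF that] b] by (simp add: o_def)
    from this LIMSEQ_Suc[OF this]
    show "(\<lambda>n. \<bar>sin (pi * real (f (b (Suc n))) * x)\<bar> + \<bar>sin (pi * real (f (b n)) * x)\<bar>) \<longlonglongrightarrow> 0"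
      by (intro tendsto_add_zero tendsto_rabs_zero)
    have "f (b n) \<le> f (b (Suc n))" for n using f b by (simp add: strict_mono_less_eq)
    then have "norm (sin (pi * real (g n) * x))
        \<le> norm (\<bar>sin (pi * real (f (b (Suc n))) * x)\<bar> + \<bar>sin (pi * real (f (b n)) * x)\<bar>) * 1" for n
      unfolding g_def
      by (simp only: real_norm_def mult_1_right) (rule order.trans[OF abs_sin_freq_diff_le abs_ge_self])
    then show "\<forall>\<^sub>F n in sequentially. norm (sin (pi * real (g n) * x))
        \<le> norm (\<bar>sin (pi * real (f (b (Suc n))) * x)\<bar> + \<bar>sin (pi * real (f (b n)) * x)\<bar>) * 1"
      by (intro always_eventually allI)
  qed
  moreover have "(\<lambda>n. sin (pi * real (g n) * x)) \<longlonglongrightarrow> 0" if x: "x \<in> X" for x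
  proof (rule LIMSEQ_I)
    fix e :: real assume "e > 0"
    then obtain N where N: "\<And>i j. i \<ge> N \<Longrightarrow> j \<ge> i \<Longrightarrow> \<bar>sin (pi * real (f (h j) - f (h i)) * x)\<bar> < e"
      using h(2)[OF x] by blast
    have "norm (sin (pi * real (g n) * x) - 0) < e" if "n \<ge> N" for n
      using N[of "r n" "r (Suc n)"] order.trans[OF that strict_mono_imp_increasing[OF r(1), of n]] r(1)
      by (simp add: g_def b_def strict_mono_less_eq)
    then show "\<exists>N. \<forall>n\<ge>N. norm (sin (pi * real (g n) * x) - 0) < e" by blast
  qed
  ultimately show ?thesis using g unfolding Arbault_set_def by (intro exI[of _ g]) auto
qed

section \<open>Arbault sets as countable unions of Hardy sets\<close>

lemma nearest_int_dist_le: "nearest_int_dist x \<le> \<bar>x - of_int m\<bar>"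
  unfolding nearest_int_dist_def using round_diff_minimal[of x m] by simp

text \<open>The size of \<open>sin (pi * y)\<close> depends only on the distance of \<open>y\<close>
  to the integers and grows with it up to \<open>1 / 2\<close>. So \<open>y\<close> is within
  \<open>1 / 8\<close> of some integer, and \<open>y - 1 / 4\<close> is within
  \<open>1 / 8 + 1 / 4\<close> of the same one.\<close>

lemma nearest_int_dist_less_of_sin_less:
  assumes "\<bar>sin (pi * y)\<bar> < sin (pi / 8)"
  shows "nearest_int_dist (y - 1 / 4) < 3 / 8"
proof -
  define m where "m = round y"
  define t where "t = y - of_int m"
  have t: "\<bar>t\<bar> \<le> 1 / 2" unfolding t_def m_def using of_int_round_abs_le[of y] by (simp add: abs_minus_commute)
  have eq: "\<bar>sin (pi * y)\<bar> = \<bar>sin (pi * t)\<bar>"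
    using abs_sin_pi_add_of_int[of t m] unfolding t_def by simp
  have "\<bar>t\<bar> < 1 / 8"
  proof (rule ccontr)
    assume "\<not> \<bar>t\<bar> < 1 / 8"
    then have "pi / 8 \<le> pi * \<bar>t\<bar>" "pi * \<bar>t\<bar> \<le> pi / 2"
      using t mult_left_mono[of "1/8" "\<bar>t\<bar>" pi] mult_left_mono[of "\<bar>t\<bar>" "1/2" pi] by auto
    then have "sin (pi / 8) \<le> sin (pi * \<bar>t\<bar>)"
      using pi_gt_zero by (intro sin_monotone_2pi_le) linarith+
    also have "\<dots> \<le> \<bar>sin (pi * t)\<bar>" by (cases "t \<ge> 0") auto
    finally show False using assms eq by simp
  qed
  then have "\<bar>y - 1 / 4 - of_int m\<bar> < 3 / 8" unfolding t_def by linarith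
  with nearest_int_dist_le[of "y - 1 / 4" m] show ?thesis by simp
qed

text \<open>Sorting points by an index \<open>k\<close> from which their sines stay below
  \<open>sin (pi / 8)\<close> gives countably many pieces. Dropping the first \<open>k\<close>
  frequencies turns the eventual bound into one for all \<open>n\<close>.\<close>

lemma Arbault_imp_Hardy_sigma:
  assumes "Arbault_set X" shows "Hardy_sigma_set X"
proof -
  obtain f :: "nat \<Rightarrow> nat" where f: "strict_mono f"
    and lim: "\<And>x. x \<in> X \<Longrightarrow> (\<lambda>n. sin (pi * real (f n) * x)) \<longlonglongrightarrow> 0"
    using assms by (auto simp: Arbault_set_def)
  define H where "H k = {x \<in> X. \<forall>n\<ge>k. \<bar>sin (pi * real (f n) * x)\<bar> < sin (pi / 8)}" for k
  have pos: "0 < sin (pi / 8 :: real)" by (intro sin_gt_zero) auto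
  have "X \<subseteq> \<Union>(range H)"
  proof
    fix x assume x: "x \<in> X"
    obtain k where "\<And>n. n \<ge> k \<Longrightarrow> norm (sin (pi * real (f n) * x) - 0) < sin (pi / 8)"
      using LIMSEQ_D[OF lim[OF x] pos] by blast
    then have "x \<in> H k" unfolding H_def using x by simp
    then show "x \<in> \<Union>(range H)" by blast
  qed
  then have "X = \<Union>(range H)" unfolding H_def by blast
  moreover have "Hardy_set (H k)" for k
    unfolding Hardy_set_def
  proof (intro exI conjI ballI allI)
    show "(1 / 4 :: real) > 0" "(1 / 4 :: real) < 1" "(3 / 8 :: real) < 1 / 2" by simp_all
    show "strict_mono (\<lambda>n. f (k + n))" using f by (simp add: strict_mono_def)
    show "nearest_int_dist (real (f (k + n)) * x - 1 / 4) < 3 / 8" if "x \<in> H k" for x n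
      using that unfolding H_def by (intro nearest_int_dist_less_of_sin_less) (simp add: mult.assoc)
  qed
  ultimately show ?thesis unfolding Hardy_sigma_set_def by (intro exI[of _ "range H"]) auto
qed

lemma Hardy_sigma_set_Un:
  assumes A: "Hardy_sigma_set A" and X: "|X| <o cardinal_s"
  shows "Hardy_sigma_set (A \<union> X)"
proof -
  \<comment> \<open>It is enough to treat \<open>X\<close> alone, since a union of two Hardy sigma
    sets is again one.\<close>
  have "Arbault_set {}" unfolding Arbault_set_def by (intro exI[of _ id]) (simp add: strict_mono_def)
  from Arbault_imp_Hardy_sigma[OF Arbault_set_Un[OF this X]]
  obtain \<G> where G: "countable \<G>" "\<And>T. T \<in> \<G> \<Longrightarrow> Hardy_set T" "X = \<Union>\<G>"
    by (auto simp: Hardy_sigma_set_def)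
  obtain \<F> where F: "countable \<F>" "\<And>T. T \<in> \<F> \<Longrightarrow> Hardy_set T" "A = \<Union>\<F>"
    using A by (auto simp: Hardy_sigma_set_def)
  show ?thesis
    unfolding Hardy_sigma_set_def using F G by (intro exI[of _ "\<F> \<union> \<G>"]) auto
qed

subsection \<open>N0 and pseudo-Dirichlet sets\<close>

text \<open>The families \<open>{C. infinite C \<and> P x C}\<close> satisfy the first two clauses
  of \<open>shattering_family\<close>, but there are fewer than \<open>cardinal_h\<close> of them.
  Hence the third clause fails, and its failure provides \<open>B\<close>.\<close>

lemma less_cardinal_h_distributive:
  assumes X: "|X| <o cardinal_h"
    and dense: "\<And>x Y. x \<in> X \<Longrightarrow> infinite Y \<Longrightarrow> \<exists>C\<subseteq>Y. infinite C \<and> P x C"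
  obtains B where "infinite B" "\<And>x. x \<in> X \<Longrightarrow> \<exists>C. P x C \<and> B \<subseteq>\<^sup>* C"
proof -
  define F where "F = (\<lambda>x. {C. infinite C \<and> P x C}) ` X"
  have "|F| \<le>o |X|" unfolding F_def by (rule card_of_image)
  with X have "\<not> shattering_family F"
    using cardinal_h_least(2) not_ordLess_ordLeq ordLeq_ordLess_trans by blast
  moreover have "\<exists>C\<in>\<A>. C \<subseteq>\<^sup>* Y" if "infinite Y" "\<A> \<in> F" for Y \<A>
    using that dense subset_imp_almost_subset unfolding F_def by blast
  ultimately obtain B where B: "infinite B" "\<forall>\<A>\<in>F. \<exists>C\<in>\<A>. B \<subseteq>\<^sup>* C"
    unfolding shattering_family_def F_def by blast
  have "\<exists>C. P x C \<and> B \<subseteq>\<^sup>* C" if "x \<in> X" for x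
    using bspec[OF B(2), of "{C. infinite C \<and> P x C}"] that by (auto simp: F_def)
  with B(1) that show ?thesis by blast
qed

text \<open>The bound depends on the position of \<open>i\<close> inside \<open>C\<close> and not on \<open>i\<close> itself: passing to an infinite
  \<open>B\<close> with \<open>B \<subseteq>\<^sup>* C\<close> shifts positions by a constant, so the bound survives up to a constant factor.\<close>

lemma small_differences_dense:
  fixes f :: "nat \<Rightarrow> nat"
  assumes f: "strict_mono f" and Y: "infinite Y"
  shows "\<exists>C\<subseteq>Y. infinite C \<and> (\<forall>i\<in>C. \<forall>j\<in>C. i < j \<longrightarrow>
           \<bar>sin (pi * real (f j - f i) * x)\<bar> \<le> (1 / 2) ^ card (C \<inter> {..<i}))"
proof -
  define h where "h = enumerate Y"
  have h: "strict_mono h" "\<And>n. h n \<in> Y"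
    using Y unfolding h_def by (auto intro: strict_mono_enumerate enumerate_in_set)
  obtain p where p: "strict_mono p" "convergent ((\<lambda>n. cos (2 * pi * real (f (h n)) * x)) \<circ> p)"
    using bounded_real_convergent_subseq[of "\<lambda>n. cos (2 * pi * real (f (h n)) * x)" 1] by auto
  obtain q where q: "strict_mono q" "convergent ((\<lambda>n. sin (2 * pi * real (f (h (p n))) * x)) \<circ> q)"
    using bounded_real_convergent_subseq[of "\<lambda>n. sin (2 * pi * real (f (h (p n))) * x)" 1] by auto
  define k where "k = h \<circ> p \<circ> q"
  have k: "strict_mono k" unfolding k_def using h p q by (intro strict_mono_o)
  have fk: "mono (f \<circ> k)" using f k by (intro strict_mono_mono strict_mono_o)
  have conv: "convergent (\<lambda>n. cos (2 * pi * real ((f \<circ> k) n) * x))"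
    "convergent (\<lambda>n. sin (2 * pi * real ((f \<circ> k) n) * x))"
    using convergent_subseq_convergent[OF p(2) q(1)] q(2) by (simp_all add: o_def k_def)
  have ex: "\<exists>N. \<forall>i\<ge>N. \<forall>j\<ge>i. \<bar>sin (pi * real (f (k j) - f (k i)) * x)\<bar> < (1 / 2) ^ n" for n :: nat
    using sin_differences_small[OF refl refl conv fk, of "(1 / 2) ^ n"]
    by (metis comp_apply half_gt_zero_iff zero_less_one zero_less_power)
  define R where "R n m \<longleftrightarrow> (\<forall>i\<ge>m. \<forall>j\<ge>i. \<bar>sin (pi * real (f (k j) - f (k i)) * x)\<bar> < (1 / 2) ^ n)" for n m :: nat
  have "\<exists>m. R 0 m" unfolding R_def by (rule ex)
  moreover have "\<exists>m'. R (Suc n) m' \<and> m < m'" for m n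
  proof -
    obtain N where "R (Suc n) N" using ex unfolding R_def by blast
    then have "R (Suc n) (max N (Suc m))" unfolding R_def by simp
    then show ?thesis by (intro exI[of _ "max N (Suc m)"]) auto
  qed
  ultimately obtain r where r: "\<And>n. R n (r n)" "\<And>n. r n < r (Suc n)"
    using dependent_nat_choice[of R "\<lambda>_ m m'. m < m'"] by blast
  have rm: "strict_mono r" using r(2) by (simp add: strict_mono_Suc_iff)
  have kr: "strict_mono (k \<circ> r)" using k rm by (rule strict_mono_o)
  define C where "C = range (k \<circ> r)"
  have "C \<subseteq> Y" unfolding C_def k_def using h(2) by auto
  moreover have "infinite C" unfolding C_def using kr by (intro range_inj_infinite strict_mono_imp_inj_on)
  moreover have "\<bar>sin (pi * real (f j - f i) * x)\<bar> \<le> (1 / 2) ^ card (C \<inter> {..<i})"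
    if "i \<in> C" "j \<in> C" "i < j" for i j
  proof -
    obtain m n where mn: "i = (k \<circ> r) m" "j = (k \<circ> r) n" using \<open>i \<in> C\<close> \<open>j \<in> C\<close> unfolding C_def by blast
    with that have "m < n" using strict_mono_less[OF kr] by simp
    \<comment> \<open>The point \<open>(k \<circ> r) m\<close> has at most \<open>m\<close>
      predecessors in \<open>C\<close>, so the accuracy \<open>(1 / 2) ^ m\<close> valid beyond
      \<open>r m\<close> becomes a bound by rank.\<close>
    have "C \<inter> {..<i} \<subseteq> (k \<circ> r) ` {..<m}"
      unfolding C_def mn using strict_mono_less[OF kr] by auto
    then have "card (C \<inter> {..<i}) \<le> card ((k \<circ> r) ` {..<m})" by (intro card_mono) auto
    also have "\<dots> \<le> m" using card_image_le[of "{..<m}" "k \<circ> r"] by simp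
    finally have "card (C \<inter> {..<i}) \<le> m" .
    moreover have "\<bar>sin (pi * real (f j - f i) * x)\<bar> < (1 / 2) ^ m"
      using r(1)[of m] strict_mono_less_eq[OF rm] \<open>m < n\<close> unfolding R_def mn by simp
    moreover have "(1 / 2 :: real) ^ m \<le> (1 / 2) ^ card (C \<inter> {..<i})"
      using calculation(1) by (intro power_decreasing) auto
    ultimately show ?thesis by linarith
  qed
  ultimately show ?thesis by blast
qed

lemma less_cardinal_h_small_differences:
  fixes f :: "nat \<Rightarrow> nat"
  assumes X: "|X| <o cardinal_h" and f: "strict_mono f"
  obtains b where "strict_mono b" "strict_mono (\<lambda>n. f (b (Suc n)) - f (b n))"
    "\<And>x. x \<in> X \<Longrightarrow> \<exists>m. \<forall>n. \<bar>sin (pi * real (f (b (Suc n)) - f (b n)) * x)\<bar> \<le> 2 ^ m * (1 / 2) ^ n"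
proof -
  define P where "P x C \<longleftrightarrow> (\<forall>i\<in>C. \<forall>j\<in>C. i < j \<longrightarrow>
    \<bar>sin (pi * real (f j - f i) * x)\<bar> \<le> (1 / 2) ^ card (C \<inter> {..<i}))" for x C
  obtain B where B: "infinite B" "\<And>x. x \<in> X \<Longrightarrow> \<exists>C. P x C \<and> B \<subseteq>\<^sup>* C"
    using less_cardinal_h_distributive[OF X, of P] small_differences_dense[OF f]
    unfolding P_def by blast
  define h where "h = enumerate B"
  have h: "strict_mono h" "\<And>n. h n \<in> B"
    using B(1) unfolding h_def by (auto intro: strict_mono_enumerate enumerate_in_set)
  have "strict_mono (f \<circ> h)" using f h(1) by (intro strict_mono_o)
  then obtain r where r: "strict_mono r" "strict_mono (\<lambda>n. (f \<circ> h) (r (Suc n)) - (f \<circ> h) (r n))"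
    by (rule strict_mono_sparse_differences)
  define b where "b = h \<circ> r"
  have b: "strict_mono b" "\<And>n. b n \<in> B"
    unfolding b_def using h r(1) by (auto intro: strict_mono_o)
  have "\<exists>m. \<forall>n. \<bar>sin (pi * real (f (b (Suc n)) - f (b n)) * x)\<bar> \<le> 2 ^ m * (1 / 2) ^ n" if x: "x \<in> X" for x
  proof -
    obtain C where C: "P x C" "B \<subseteq>\<^sup>* C" using B(2)[OF x] by blast
    have "finite (b -` (B - C))"
      using C(2) b(1) unfolding almost_subset_def
      by (intro finite_vimageI) (auto intro: strict_mono_imp_inj_on)
    then obtain m where "b -` (B - C) \<subseteq> {..<m}" using finite_nat_bounded by metis
    then have m: "b n \<in> C" if "n \<ge> m" for n using that b(2)[of n] by fastforce
    have "\<bar>sin (pi * real (f (b (Suc n)) - f (b n)) * x)\<bar> \<le> 2 ^ m * (1 / 2) ^ n" for n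
    proof (cases "n \<ge> m")
      case True
      \<comment> \<open>From index \<open>m\<close> on, \<open>b\<close> stays in \<open>C\<close>,
        so \<open>b m, ..., b (n - 1)\<close> force the rank of \<open>b n\<close> in
        \<open>C\<close> to be at least \<open>n - m\<close>. The missing \<open>m\<close> halvings
        become the factor \<open>2 ^ m\<close>.\<close>
      have "b ` {m..<n} \<subseteq> C \<inter> {..<b n}" using m b(1) by (auto simp: strict_mono_less)
      then have "card (b ` {m..<n}) \<le> card (C \<inter> {..<b n})" by (intro card_mono) auto
      then have "n - m \<le> card (C \<inter> {..<b n})"
        using b(1) by (subst (asm) card_image) (auto intro: strict_mono_imp_inj_on)
      moreover have "\<bar>sin (pi * real (f (b (Suc n)) - f (b n)) * x)\<bar> \<le> (1 / 2) ^ card (C \<inter> {..<b n})"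
        using C(1) m True strict_mono_less[OF b(1)] unfolding P_def by simp
      moreover have "(1 / 2 :: real) ^ card (C \<inter> {..<b n}) \<le> (1 / 2) ^ (n - m)"
        using calculation(1) by (intro power_decreasing) auto
      ultimately have "\<bar>sin (pi * real (f (b (Suc n)) - f (b n)) * x)\<bar> \<le> (1 / 2) ^ (n - m)"
        by (metis order.trans)
      also have "\<dots> = 2 ^ m * (1 / 2) ^ n" using True by (simp add: power_diff power_divide)
      finally show ?thesis .
    next
      case False
      \<comment> \<open>Before index \<open>m\<close> the right-hand side is at least 1, so the
        bound is trivial.\<close>
      have "(1::real) \<le> 2 ^ (m - n)" by simp
      also have "\<dots> = 2 ^ m * (1 / 2) ^ n" using False by (simp add: power_diff power_divide)
      finally show ?thesis using abs_sin_le_one order.trans by blast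
    qed
    then show ?thesis by blast
  qed
  moreover have "strict_mono (\<lambda>n. f (b (Suc n)) - f (b n))" using r(2) unfolding b_def by simp
  ultimately show ?thesis using b(1) that by blast
qed

lemma N0_set_Un:
  assumes A: "N0_set A" and X: "|X| <o cardinal_h"
  shows "N0_set (A \<union> X)"
proof -
  obtain f :: "nat \<Rightarrow> nat" where f: "strict_mono f"
    and sm: "\<And>x. x \<in> A \<Longrightarrow> summable (\<lambda>n. \<bar>sin (pi * real (f n) * x)\<bar>)"
    using A by (auto simp: N0_set_def)
  obtain b where b: "strict_mono b" "strict_mono (\<lambda>n. f (b (Suc n)) - f (b n))"
    "\<And>x. x \<in> X \<Longrightarrow> \<exists>m. \<forall>n. \<bar>sin (pi * real (f (b (Suc n)) - f (b n)) * x)\<bar> \<le> 2 ^ m * (1 / 2) ^ n"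
    using less_cardinal_h_small_differences[OF X f] by blast
  have "summable (\<lambda>n. \<bar>sin (pi * real (f (b (Suc n)) - f (b n)) * x)\<bar>)" if x: "x \<in> A" for x
  proof (rule summable_comparison_test')
    have sb: "summable (\<lambda>n. \<bar>sin (pi * real (f (b n)) * x)\<bar>)"
      using summable_reindex[OF sm[OF x], of b] b(1) by (simp add: o_def strict_mono_imp_inj_on)
    then have "summable (\<lambda>n. \<bar>sin (pi * real (f (b (Suc n))) * x)\<bar>)"
      by (subst summable_Suc_iff)
    then show "summable (\<lambda>n. \<bar>sin (pi * real (f (b (Suc n))) * x)\<bar> + \<bar>sin (pi * real (f (b n)) * x)\<bar>)"
      using sb by (rule summable_add)
    show "norm \<bar>sin (pi * real (f (b (Suc n)) - f (b n)) * x)\<bar>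
        \<le> \<bar>sin (pi * real (f (b (Suc n))) * x)\<bar> + \<bar>sin (pi * real (f (b n)) * x)\<bar>" for n
      unfolding real_norm_def abs_idempotent using f b(1)
      by (intro abs_sin_freq_diff_le) (simp add: strict_mono_less_eq)
  qed
  moreover have "summable (\<lambda>n. \<bar>sin (pi * real (f (b (Suc n)) - f (b n)) * x)\<bar>)" if x: "x \<in> X" for x
  proof -
    obtain m where m: "\<And>n. \<bar>sin (pi * real (f (b (Suc n)) - f (b n)) * x)\<bar> \<le> 2 ^ m * (1 / 2) ^ n"
      using b(3)[OF x] by blast
    show ?thesis
      by (rule summable_comparison_test'[OF summable_mult[OF summable_geometric[of "1 / 2"], of "2 ^ m"]])
        (use m in auto)
  qed
  ultimately show ?thesis
    unfolding N0_set_def using b(2) by (intro exI[of _ "\<lambda>n. f (b (Suc n)) - f (b n)"]) auto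
qed

lemma pseudo_Dirichlet_set_Un:
  assumes A: "pseudo_Dirichlet_set A" and X: "|X| <o cardinal_h"
  shows "pseudo_Dirichlet_set (A \<union> X)"
proof -
  obtain e :: "nat \<Rightarrow> real" and f :: "nat \<Rightarrow> nat" where e: "e \<longlonglongrightarrow> 0" and f: "strict_mono f"
    and s: "\<And>x. x \<in> A \<Longrightarrow> \<forall>\<^sub>F n in sequentially. \<bar>sin (pi * real (f n) * x)\<bar> < e n"
    using A by (auto simp: pseudo_Dirichlet_set_def)
  obtain b where b: "strict_mono b" "strict_mono (\<lambda>n. f (b (Suc n)) - f (b n))"
    "\<And>x. x \<in> X \<Longrightarrow> \<exists>m. \<forall>n. \<bar>sin (pi * real (f (b (Suc n)) - f (b n)) * x)\<bar> \<le> 2 ^ m * (1 / 2) ^ n"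
    using less_cardinal_h_small_differences[OF X f] by blast
  \<comment> \<open>One error sequence must serve every point. Since
    \<open>1 / 2 = 2 / 3 * 3 / 4\<close>, the term \<open>(3 / 4) ^ n\<close> eventually exceeds
    \<open>2 ^ m * (1 / 2) ^ n\<close> for any \<open>m\<close>; the absolute values keep the other
    terms from spoiling this.\<close>
  define d where "d n = \<bar>e (b (Suc n))\<bar> + \<bar>e (b n)\<bar> + (3 / 4) ^ n" for n
  have eb: "(\<lambda>n. e (b n)) \<longlonglongrightarrow> 0" using LIMSEQ_subseq_LIMSEQ[OF e b(1)] by (simp add: o_def)
  have "d \<longlonglongrightarrow> 0"
    unfolding d_def using eb LIMSEQ_Suc[OF eb]
    by (intro tendsto_add_zero tendsto_rabs_zero LIMSEQ_realpow_zero) auto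
  moreover have "\<forall>\<^sub>F n in sequentially. \<bar>sin (pi * real (f (b (Suc n)) - f (b n)) * x)\<bar> < d n"
    if x: "x \<in> A" for x
  proof -
    have ev: "\<forall>\<^sub>F n in sequentially. \<bar>sin (pi * real (f (b n)) * x)\<bar> < e (b n)"
      using eventually_subseq[OF b(1) s[OF x]] .
    have ev': "\<forall>\<^sub>F n in sequentially. \<bar>sin (pi * real (f (b (Suc n))) * x)\<bar> < e (b (Suc n))"
      using eventually_sequentially_Suc[THEN iffD2, OF ev] .
    from ev ev' show ?thesis
    proof eventually_elim
      case (elim n)
      have "\<bar>sin (pi * real (f (b (Suc n)) - f (b n)) * x)\<bar>
          \<le> \<bar>sin (pi * real (f (b (Suc n))) * x)\<bar> + \<bar>sin (pi * real (f (b n)) * x)\<bar>"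
        using f b(1) by (intro abs_sin_freq_diff_le) (simp add: strict_mono_less_eq)
      moreover have "(0::real) < (3 / 4) ^ n" by simp
      ultimately show ?case using elim unfolding d_def by linarith
    qed
  qed
  moreover have "\<forall>\<^sub>F n in sequentially. \<bar>sin (pi * real (f (b (Suc n)) - f (b n)) * x)\<bar> < d n"
    if x: "x \<in> X" for x
  proof -
    obtain m where m: "\<And>n. \<bar>sin (pi * real (f (b (Suc n)) - f (b n)) * x)\<bar> \<le> 2 ^ m * (1 / 2) ^ n"
      using b(3)[OF x] by blast
    have "(\<lambda>n. 2 ^ m * (2 / 3 :: real) ^ n) \<longlonglongrightarrow> 0"
      by (intro tendsto_mult_right_zero LIMSEQ_realpow_zero) auto
    then have "\<forall>\<^sub>F n in sequentially. 2 ^ m * (2 / 3 :: real) ^ n < 1"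
      by (rule order_tendstoD) simp
    then show ?thesis
    proof eventually_elim
      case (elim n)
      have "2 ^ m * (1 / 2 :: real) ^ n = 2 ^ m * (2 / 3) ^ n * (3 / 4) ^ n"
        by (simp flip: power_mult_distrib add: mult.assoc)
      also have "\<dots> < 1 * (3 / 4) ^ n" using elim by (intro mult_strict_right_mono) auto
      finally show ?case using m[of n] unfolding d_def by linarith
    qed
  qed
  ultimately show ?thesis
    unfolding pseudo_Dirichlet_set_def using b(2)
    by (intro exI[of _ d] exI[of _ "\<lambda>n. f (b (Suc n)) - f (b n)"]) auto
qed

subsection \<open>Chains and fusion below the tower number\<close>

text \<open>Towers are indexed by cardinal orders, but recursions of length below \<^const>\<open>cardinal_t\<close> produce
  chains of arbitrary order type; those are thinned out to a coinitial tower of minimal cardinality.\<close>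

lemma almost_chain_pseudointersection:
  fixes C :: "nat set set"
  assumes inf: "\<And>c. c \<in> C \<Longrightarrow> infinite c"
    and chain: "\<And>c d. c \<in> C \<Longrightarrow> d \<in> C \<Longrightarrow> c \<subseteq>\<^sup>* d \<or> d \<subseteq>\<^sup>* c"
    and card: "|C| <o cardinal_t"
  shows "\<exists>B. infinite B \<and> (\<forall>c\<in>C. B \<subseteq>\<^sup>* c)"
proof (rule ccontr)
  assume nopi: "\<not> (\<exists>B. infinite B \<and> (\<forall>c\<in>C. B \<subseteq>\<^sup>* c))"
  define coinit where "coinit D \<longleftrightarrow> D \<subseteq> C \<and> (\<forall>c\<in>C. \<exists>d\<in>D. d \<subseteq>\<^sup>* c)" for D
  have "coinit C" unfolding coinit_def using almost_subset_refl by blast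
  then have ne: "{|D| | D. coinit D} \<noteq> {}" by blast
  have co: "\<forall>r\<in>{|D| | D. coinit D}. Card_order r" by (auto simp: card_of_Card_order)
  obtain D where D: "coinit D" and Dmin: "\<And>E. coinit E \<Longrightarrow> |D| \<le>o |E|"
    using exists_minim_Card_order[OF ne co] by blast
  have DC: "D \<subseteq> C" using D unfolding coinit_def by blast
  have wo: "Well_order |D|" and fld: "Field |D| = D"
    by (rule card_of_Well_order Field_card_of)+
  have "antisym |D|" "Refl |D|" using wo by (simp_all add: order_on_defs)
  \<comment> \<open>Only members almost contained in all earlier members of \<open>D\<close> are
    kept, so that index order and almost inclusion agree.\<close>
  define S where "S = {c \<in> D. \<forall>d\<in>D. (d, c) \<in> |D| \<and> d \<noteq> c \<longrightarrow> c \<subseteq>\<^sup>* d}"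
  have SD: "S \<subseteq> D" unfolding S_def by blast
  have "coinit S"
    unfolding coinit_def
  proof (intro conjI ballI)
    show "S \<subseteq> C" using SD DC by blast
    fix c assume c: "c \<in> C"
    \<comment> \<open>The \<open>|D|\<close>-least element \<open>d\<close> of \<open>W\<close>
      survives in \<open>S\<close>: an earlier element of \<open>D\<close> is not almost below
      \<open>c\<close>, hence by comparability almost above \<open>c\<close> and so above
      \<open>d\<close>.\<close>
    define W where "W = {d \<in> D. d \<subseteq>\<^sup>* c}"
    have "W \<noteq> {}" "W \<subseteq> Field |D|" using D c fld unfolding coinit_def W_def by auto
    then obtain d where d: "d \<in> W" and dmin: "\<And>e. e \<in> W \<Longrightarrow> (d, e) \<in> |D|"
      using wo_rel.minim_in[of "|D|" W] wo_rel.minim_least[of "|D|" W] wo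
      unfolding wo_rel_def by metis
    have "d \<subseteq>\<^sup>* e" if e: "e \<in> D" "(e, d) \<in> |D|" "e \<noteq> d" for e
    proof -
      have "e \<notin> W" using dmin e \<open>antisym |D|\<close> by (meson antisymD)
      then have "\<not> e \<subseteq>\<^sup>* c" using e unfolding W_def by blast
      then have "c \<subseteq>\<^sup>* e" using chain[of c e] c e DC by blast
      then show ?thesis using d almost_subset_trans unfolding W_def by blast
    qed
    then show "\<exists>d\<in>S. d \<subseteq>\<^sup>* c" using d unfolding S_def W_def by blast
  qed
  define r where "r = Restr |D| S"
  have wor: "Well_order r" unfolding r_def using wo by (rule Well_order_Restr)
  have fr: "Field r = S"
    unfolding r_def using SD fld \<open>Refl |D|\<close> by (simp add: Refl_Field_Restr2)
  \<comment> \<open>To be a tower length, \<open>r\<close> must be a cardinal order. A proper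
    initial segment of \<open>r\<close> lies in one of \<open>|D|\<close>, which is smaller than
    \<open>|D|\<close>, and \<open>|D| \<le>o |S|\<close> by minimality.\<close>
  have "Restr r (underS r a) <o |Field r|" if a: "a \<in> Field r" for a
  proof (rule ccontr)
    assume "\<not> Restr r (underS r a) <o |Field r|"
    then have "|S| \<le>o Restr r (underS r a)"
      using not_ordLess_iff_ordLeq Well_order_Restr[OF wor] card_of_Well_order unfolding fr by blast
    from card_of_mono2[OF this] have "|S| \<le>o |Field (Restr r (underS r a))|"
      by (simp add: Field_card_of)
    also have "|Field (Restr r (underS r a))| \<le>o |underS ( |D| ) a|"
      using Field_Restr_subset[of r "underS r a"]
      by (intro card_of_mono1) (auto simp: underS_def r_def)
    also have "|underS ( |D| ) a| <o |D|"
      using a fr SD fld card_of_Card_order[of D] by (intro card_of_underS) auto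
    also have "|D| \<le>o |S|" using Dmin \<open>coinit S\<close> .
    finally show False using ordLess_irreflexive by blast
  qed
  then have "Card_order r" using Card_order_iff_Restr_underS[OF wor] by blast
  \<comment> \<open>Indices of towers are themselves sets of naturals, so \<open>S\<close> is
    indexed by its own members through \<open>id\<close>.\<close>
  moreover have "\<forall>\<alpha>\<in>Field r. infinite (id \<alpha>)" using fr SD DC inf by auto
  moreover have "\<forall>\<alpha> \<beta>. (\<beta>, \<alpha>) \<in> r \<longrightarrow> id \<alpha> \<subseteq>\<^sup>* id \<beta>"
    unfolding r_def S_def using almost_subset_refl by auto
  moreover have "\<not> (\<exists>B. infinite B \<and> (\<forall>\<alpha>\<in>Field r. B \<subseteq>\<^sup>* id \<alpha>))"
    using nopi \<open>coinit S\<close> almost_subset_trans unfolding fr coinit_def id_def by meson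
  ultimately have "r \<in> tower_lengths" unfolding tower_lengths_def by blast
  then have "cardinal_t \<le>o r" by (rule cardinal_t_least(2))
  also have "r \<le>o |C|"
    using ordIso_symmetric[OF card_of_Field_ordIso[OF \<open>Card_order r\<close>]] card_of_mono1[of S C] SD DC
    unfolding fr by (blast intro: ordIso_ordLeq_trans)
  also note card
  finally show False using ordLess_irreflexive by blast
qed

text \<open>The recursion runs along the well-order \<open>|X|\<close>: at \<open>x\<close>, a lower
  bound of the earlier choices is strengthened by \<open>dense\<close>. A lower bound of all choices
  inherits every requirement by \<open>closed\<close>. Applied to the empty chain,
  \<open>lower\<close> also supplies the starting condition.\<close>

lemma transfinite_fusion:
  fixes le :: "'p \<Rightarrow> 'p \<Rightarrow> bool" and D :: "'x \<Rightarrow> 'p \<Rightarrow> bool"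
  assumes refl: "\<And>p. le p p" and trans: "\<And>p q r. le p q \<Longrightarrow> le q r \<Longrightarrow> le p r"
    and lower: "\<And>K. K \<subseteq> P \<Longrightarrow> (\<And>p q. p \<in> K \<Longrightarrow> q \<in> K \<Longrightarrow> le p q \<or> le q p) \<Longrightarrow> |K| \<le>o |X|
      \<Longrightarrow> \<exists>p\<in>P. \<forall>q\<in>K. le p q"
    and dense: "\<And>x p. x \<in> X \<Longrightarrow> p \<in> P \<Longrightarrow> \<exists>q\<in>P. le q p \<and> D x q"
    and closed: "\<And>x p q. x \<in> X \<Longrightarrow> D x p \<Longrightarrow> le q p \<Longrightarrow> D x q"
  obtains p where "p \<in> P" "\<And>x. x \<in> X \<Longrightarrow> D x p"
proof -
  define R where "R = ( |X| ) - Id"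
  have wo: "Well_order ( |X| )" and fld: "Field ( |X| ) = X"
    by (rule card_of_Well_order Field_card_of)+
  then have "wf R" and tot: "\<And>x y. x \<in> X \<Longrightarrow> y \<in> X \<Longrightarrow> (x, y) \<in> R \<or> x = y \<or> (y, x) \<in> R"
    unfolding R_def by (auto simp: order_on_defs total_on_def)
  have RX: "x \<in> X" "y \<in> X" if "(x, y) \<in> R" for x y
    using that fld unfolding R_def Field_def by auto
  have RT: "(x, z) \<in> R" if "(x, y) \<in> R" "(y, z) \<in> R" for x y z
  proof -
    have "trans ( |X| )" "antisym ( |X| )" using wo by (simp_all add: order_on_defs)
    with that show ?thesis unfolding R_def by (metis Diff_iff antisymD pair_in_Id_conv transD)
  qed
  \<comment> \<open>The recursion principle produces a total function, so nothing is demanded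
    outside \<open>X\<close>.\<close>
  define Q where "Q f x p \<longleftrightarrow> (x \<in> X \<longrightarrow> p \<in> P \<and> D x p \<and> (\<forall>y. (y, x) \<in> R \<longrightarrow> le p (f y)))"
    for f :: "'x \<Rightarrow> 'p" and x p
  have chain: "le (f y) (f z) \<or> le (f z) (f y)"
    if "y \<in> X" "z \<in> X" "Q f y (f y)" "Q f z (f z)" for f y z
    using tot[OF that(1,2)] that refl unfolding Q_def by auto
  have "\<exists>f. \<forall>x. Q f x (f x)"
  proof (rule dependent_wf_choice[OF \<open>wf R\<close>])
    show "Q f x p = Q g x p" if "\<And>z. (z, x) \<in> R \<Longrightarrow> f z = g z" for f g x p
      using that unfolding Q_def by auto
    show "\<exists>p. Q f x p" if Q: "\<And>y. (y, x) \<in> R \<Longrightarrow> Q f y (f y)" for x f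
    proof (cases "x \<in> X")
      case True
      let ?K = "f ` {y. (y, x) \<in> R}"
      have "?K \<subseteq> P" using Q RX(1) unfolding Q_def by blast
      moreover have "le p q \<or> le q p" if pq: "p \<in> ?K" "q \<in> ?K" for p q
      proof -
        obtain y z where "p = f y" "(y, x) \<in> R" "q = f z" "(z, x) \<in> R" using pq by blast
        then show ?thesis using chain[of y z f] RX(1) Q by simp
      qed
      moreover have "|?K| \<le>o |X|"
        using RX(1) by (intro ordLeq_transitive[OF card_of_image card_of_mono1]) auto
      ultimately obtain p where p: "p \<in> P" "\<forall>q\<in>?K. le p q" using lower by metis
      obtain q where q: "q \<in> P" "le q p" "D x q" using dense[OF True p(1)] by blast
      have "le q (f y)" if "(y, x) \<in> R" for y using that p(2) q(2) trans by blast
      with q show ?thesis unfolding Q_def by blast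
    qed (simp add: Q_def)
  qed
  then obtain f where f: "\<And>x. Q f x (f x)" by blast
  have "f ` X \<subseteq> P" using f unfolding Q_def by blast
  moreover have "le p q \<or> le q p" if pq: "p \<in> f ` X" "q \<in> f ` X" for p q
    using pq chain f by blast
  ultimately obtain p where p: "p \<in> P" "\<forall>q\<in>f ` X. le p q" using lower[of "f ` X"] card_of_image by metis
  have "D x p" if "x \<in> X" for x
  proof -
    have "le p (f x)" using p(2) that by blast
    then show ?thesis using closed[OF that] f[of x] that unfolding Q_def by blast
  qed
  with p(1) that show ?thesis by blast
qed

section \<open>Block conditions and lower bounds of their chains\<close>

text \<open>The weight demanded in block \<open>j\<close> grows with the rank of \<open>j\<close> among the nonempty blocks. Deleting a
  single block therefore frees a factor \<open>2 ^ j\<close> in every later block, which pays for a refinement into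
  \<open>2 ^ j\<close> arcs of the circle. The ranks also make the weights tend to infinity at a rate that can be
  preserved at limit steps without appealing to a dominating function.\<close>

definition block_condition :: "(nat \<Rightarrow> real) \<Rightarrow> (nat \<Rightarrow> nat set) \<Rightarrow> (nat \<Rightarrow> nat set) \<Rightarrow> bool" where
  "block_condition a I F \<longleftrightarrow> (\<forall>j. F j \<subseteq> I j) \<and> infinite {j. F j \<noteq> {}} \<and>
     (\<forall>j. F j \<noteq> {} \<longrightarrow> 2 ^ (j * card ({i. F i \<noteq> {}} \<inter> {..<j})) \<le> sum a (F j))"

definition block_le :: "(nat \<Rightarrow> nat set) \<Rightarrow> (nat \<Rightarrow> nat set) \<Rightarrow> bool" where
  "block_le F G \<longleftrightarrow> finite {j. \<not> F j \<subseteq> G j}"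

lemma block_le_refl: "block_le F F"
  by (simp add: block_le_def)

lemma block_le_trans:
  assumes "block_le F G" "block_le G H" shows "block_le F H"
proof -
  have "{j. \<not> F j \<subseteq> H j} \<subseteq> {j. \<not> F j \<subseteq> G j} \<union> {j. \<not> G j \<subseteq> H j}" by blast
  then show ?thesis using assms unfolding block_le_def by (meson finite_UnI finite_subset)
qed

text \<open>Taking every second element halves the ranks. Lower bounds of chains use this to match
  the weight of a block, known only with exponent \<open>j * (r j div 2)\<close>, with its rank in
  the new support.\<close>

lemma infinite_subset_half_rank:
  fixes J :: "nat set"
  assumes J: "infinite J"
  obtains L where "L \<subseteq> J" "infinite L"
    "\<And>j. j \<in> L \<Longrightarrow> 2 * card (L \<inter> {..<j}) \<le> card (J \<inter> {..<j})"
proof -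
  let ?e = "enumerate J"
  have e: "strict_mono ?e" using J by (rule strict_mono_enumerate)
  define L where "L = range (\<lambda>n. ?e (2 * n))"
  have "L \<subseteq> J" unfolding L_def using enumerate_in_set[OF J] by auto
  moreover have "infinite L"
    unfolding L_def by (rule range_inj_infinite) (simp add: inj_def strict_mono_eq[OF e])
  moreover have "2 * card (L \<inter> {..<j}) \<le> card (J \<inter> {..<j})" if jL: "j \<in> L" for j
  proof -
    obtain n where j: "j = ?e (2 * n)" using jL unfolding L_def by blast
    have "L \<inter> {..<j} \<subseteq> (\<lambda>n. ?e (2 * n)) ` {..<n}"
      unfolding L_def j using strict_mono_less[OF e] by auto
    then have "card (L \<inter> {..<j}) \<le> card ((\<lambda>n. ?e (2 * n)) ` {..<n})" by (intro card_mono) auto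
    also have "\<dots> \<le> n" using card_image_le[of "{..<n}"] by simp
    finally have "2 * card (L \<inter> {..<j}) \<le> 2 * n" by simp
    also have "\<dots> = card (?e ` {..<2 * n})"
      using strict_mono_imp_inj_on[OF e] by (subst card_image) (auto intro: inj_on_subset)
    also have "\<dots> \<le> card (J \<inter> {..<j})"
      unfolding j using enumerate_in_set[OF J] strict_mono_less[OF e] by (intro card_mono) auto
    finally show ?thesis .
  qed
  ultimately show ?thesis by (rule that)
qed

lemma infinite_rank_unbounded:
  fixes J :: "nat set"
  assumes J: "infinite J"
  obtains N where "\<And>j. j \<ge> N \<Longrightarrow> k \<le> card (J \<inter> {..<j})"
proof -
  obtain T where T: "finite T" "card T = k" "T \<subseteq> J" using infinite_arbitrarily_large[OF J] by blast
  obtain N where N: "T \<subseteq> {..<N}" using finite_nat_bounded[OF T(1)] by metis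
  have "k \<le> card (J \<inter> {..<j})" if "j \<ge> N" for j
    unfolding T(2)[symmetric] using T(3) N that by (intro card_mono) auto
  then show ?thesis by (rule that)
qed

text \<open>Pseudointersections are taken twice: of the supports, giving a common set
  \<open>J\<close> of blocks, and then of the sets of coded pieces that carry enough weight. All but
  finitely many of the resulting pieces lie in any given \<open>F\<close>, and \<open>H\<close>
  keeps one piece per block.\<close>

lemma block_chain_lower_bound:
  assumes fin: "\<And>j. finite (I j)" and top: "block_condition a I I"
    and K: "\<And>F. F \<in> K \<Longrightarrow> block_condition a I F"
    and chain: "\<And>F G. F \<in> K \<Longrightarrow> G \<in> K \<Longrightarrow> block_le F G \<or> block_le G F"
    and card: "|K| <o cardinal_t"
  shows "\<exists>H. block_condition a I H \<and> (\<forall>F\<in>K. block_le H F)"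
proof (cases "K = {}")
  case True
  with top show ?thesis by blast
next
  case False
  then obtain F0 where F0: "F0 \<in> K" by blast
  define supp where "supp F = {j :: nat. F j \<noteq> {}}" for F :: "nat \<Rightarrow> nat set"
  have FI: "F j \<subseteq> I j" if "F \<in> K" for F j using K[OF that] unfolding block_condition_def by blast
  have cardimg: "|g ` K| <o cardinal_t" for g :: "(nat \<Rightarrow> nat set) \<Rightarrow> nat set"
    using card_of_image card by (rule ordLeq_ordLess_trans)
  have sub: "supp F \<subseteq>\<^sup>* supp G" if "block_le F G" for F G
    using that unfolding block_le_def almost_subset_def supp_def
    by (rule rev_finite_subset) auto
  have "\<exists>J. infinite J \<and> (\<forall>c\<in>supp ` K. J \<subseteq>\<^sup>* c)"
  proof (rule almost_chain_pseudointersection)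
    show "infinite c" if "c \<in> supp ` K" for c
      using that K unfolding block_condition_def supp_def by auto
    show "c \<subseteq>\<^sup>* d \<or> d \<subseteq>\<^sup>* c" if "c \<in> supp ` K" "d \<in> supp ` K" for c d
      using that chain sub by blast
  qed (rule cardimg)
  then obtain J where J: "infinite J" "\<And>F. F \<in> K \<Longrightarrow> J \<subseteq>\<^sup>* supp F" by blast
  \<comment> \<open>Ranks with respect to \<open>J\<close> and to the support of \<open>F\<close> differ by a constant, so half of the rank in \<open>J\<close>
    is eventually affordable for every \<open>F\<close>. With this common threshold the finite subsets of the
    blocks, coded as numbers, form a chain of infinite sets again.\<close>
  define r where "r j = card (J \<inter> {..<j})" for j
  define code where "code j G = prod_encode (j, set_encode G)" for j :: nat and G
  have code_eq: "code j G = code j' G' \<longleftrightarrow> j = j' \<and> G = G'" if "finite G" "finite G'" for j j' G G'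
    unfolding code_def using that by (auto simp: set_encode_eq)
  have code_fst: "j = j'" if "code j G = code j' G'" for j j' G G'
    using that unfolding code_def by simp
  define E where "E F = {code j G | j G. j \<in> J \<and> G \<subseteq> F j \<and> G \<noteq> {} \<and> 2 ^ (j * (r j div 2)) \<le> sum a G}"
    for F
  have E_iff: "code j G \<in> E F \<longleftrightarrow> j \<in> J \<and> G \<subseteq> F j \<and> G \<noteq> {} \<and> 2 ^ (j * (r j div 2)) \<le> sum a G"
    if "F \<in> K" "finite G" for F j G
  proof -
    have "finite G'" if "G' \<subseteq> F j'" for j' G'
      using that FI[OF \<open>F \<in> K\<close>] fin by (meson finite_subset)
    then show ?thesis unfolding E_def using code_eq[OF \<open>finite G\<close>] by auto
  qed
  have infE: "infinite (E F)" if F: "F \<in> K" for F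
  proof -
    \<comment> \<open>The rank in \<open>supp F\<close> is at least \<open>r j - c\<close>. As soon
      as \<open>r j\<close> reaches \<open>2 * c\<close>, this is at least \<open>r j div 2\<close>,
      so the whole block \<open>F j\<close> qualifies as a piece.\<close>
    define c where "c = card (J - supp F)"
    have finc: "finite (J - supp F)" using J(2)[OF F] unfolding almost_subset_def .
    obtain N where N: "\<And>j. j \<ge> N \<Longrightarrow> 2 * c \<le> r j"
      unfolding r_def using infinite_rank_unbounded[OF J(1)] by metis
    define M where "M = J - ((J - supp F) \<union> {..<N})"
    have "infinite M" unfolding M_def using J(1) finc by (intro Diff_infinite_finite) auto
    moreover have "code j (F j) \<in> E F" if "j \<in> M" for j
    proof -
      have j: "j \<in> J" "F j \<noteq> {}" "2 * c \<le> r j" using that N unfolding M_def supp_def by auto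
      have "J \<inter> {..<j} \<subseteq> (supp F \<inter> {..<j}) \<union> (J - supp F)" by blast
      then have "r j \<le> card ((supp F \<inter> {..<j}) \<union> (J - supp F))"
        unfolding r_def using finc by (intro card_mono) auto
      also have "\<dots> \<le> card (supp F \<inter> {..<j}) + c" unfolding c_def by (rule card_Un_le)
      finally have "r j div 2 \<le> card (supp F \<inter> {..<j})" using j(3) by linarith
      then have "(2::real) ^ (j * (r j div 2)) \<le> 2 ^ (j * card (supp F \<inter> {..<j}))"
        by (intro power_increasing mult_le_mono2) auto
      also have "\<dots> \<le> sum a (F j)"
        using K[OF F] j(2) unfolding block_condition_def supp_def by blast
      finally show ?thesis
        using j FI[OF F] fin E_iff[OF F, of "F j" j] by (meson finite_subset order_refl)
    qed
    moreover have "inj_on (\<lambda>j. code j (F j)) M" using code_fst by (intro inj_onI)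
    ultimately show ?thesis by (meson finite_subset finite_imageD image_subsetI)
  qed
  have subE: "E F \<subseteq>\<^sup>* E G" if "F \<in> K" "G \<in> K" "block_le F G" for F G
  proof -
    let ?Z = "{j. \<not> F j \<subseteq> G j}"
    \<comment> \<open>A piece of \<open>F\<close> can fail for \<open>G\<close> only in the finitely
      many blocks where \<open>F j\<close> is not inside \<open>G j\<close>, and each finite block
      has finitely many pieces.\<close>
    have "E F - E G \<subseteq> (\<lambda>(j, G). code j G) ` (SIGMA j:?Z. Pow (I j))"
    proof
      fix e assume e: "e \<in> E F - E G"
      then obtain j S where S: "e = code j S" "j \<in> J" "S \<subseteq> F j" "S \<noteq> {}" "2 ^ (j * (r j div 2)) \<le> sum a S"
        unfolding E_def by blast
      then have "\<not> S \<subseteq> G j" using e unfolding E_def by blast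
      then have "(j, S) \<in> (SIGMA j:?Z. Pow (I j))" using S(3) FI[OF that(1), of j] by auto
      then show "e \<in> (\<lambda>(j, G). code j G) ` (SIGMA j:?Z. Pow (I j))"
        unfolding S(1) by (rule rev_image_eqI) simp
    qed
    moreover have "finite (SIGMA j:?Z. Pow (I j))"
      using that(3) fin unfolding block_le_def by (intro finite_SigmaI) auto
    ultimately show ?thesis unfolding almost_subset_def by (meson finite_imageI finite_subset)
  qed
  have "\<exists>B. infinite B \<and> (\<forall>c\<in>E ` K. B \<subseteq>\<^sup>* c)"
  proof (rule almost_chain_pseudointersection)
    show "infinite c" if "c \<in> E ` K" for c using that infE by auto
    show "c \<subseteq>\<^sup>* d \<or> d \<subseteq>\<^sup>* c" if "c \<in> E ` K" "d \<in> E ` K" for c d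
      using that chain subE by blast
  qed (rule cardimg)
  then obtain B0 where B0: "infinite B0" "\<And>F. F \<in> K \<Longrightarrow> B0 \<subseteq>\<^sup>* E F" by blast
  \<comment> \<open>A pseudointersection may contain stray numbers; intersecting with
    \<open>E F0\<close> ensures that every element codes a piece.\<close>
  define B where "B = B0 \<inter> E F0"
  have "infinite (B0 - (B0 - E F0))"
    using B0(1) B0(2)[OF F0] unfolding almost_subset_def by (intro Diff_infinite_finite)
  then have B: "infinite B" "B \<subseteq> E F0" unfolding B_def by (simp_all add: Diff_Diff_Int)
  have BE: "finite (B - E F)" if "F \<in> K" for F
    using B0(2)[OF that] unfolding almost_subset_def B_def by (rule rev_finite_subset) blast
  define J1 where "J1 = {j. \<exists>G. finite G \<and> code j G \<in> B}"
  \<comment> \<open>Each finite block contributes finitely many codes, so infinitely many codes must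
    come from infinitely many blocks.\<close>
  have "B \<subseteq> (\<lambda>(j, G). code j G) ` (SIGMA j:J1. Pow (I j))"
  proof
    fix e assume e: "e \<in> B"
    then obtain j S where S: "e = code j S" "S \<subseteq> F0 j" using B(2) unfolding E_def by blast
    then have "S \<subseteq> I j" using FI[OF F0] by blast
    moreover from this have "finite S" using fin by (rule finite_subset)
    ultimately have "(j, S) \<in> (SIGMA j:J1. Pow (I j))" using e S(1) unfolding J1_def by blast
    then show "e \<in> (\<lambda>(j, G). code j G) ` (SIGMA j:J1. Pow (I j))"
      unfolding S(1) by (rule rev_image_eqI) simp
  qed
  then have "infinite J1" using B(1) fin by (meson finite_Pow_iff finite_SigmaI finite_imageI finite_subset)
  obtain G where G: "\<And>j. j \<in> J1 \<Longrightarrow> finite (G j)" "\<And>j. j \<in> J1 \<Longrightarrow> code j (G j) \<in> B"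
  proof -
    have "\<forall>j. \<exists>G. j \<in> J1 \<longrightarrow> finite G \<and> code j G \<in> B" unfolding J1_def by blast
    from choice[OF this] show ?thesis using that by blast
  qed
  have GE: "j \<in> J" "G j \<subseteq> F0 j" "G j \<noteq> {}" "2 ^ (j * (r j div 2)) \<le> sum a (G j)" if "j \<in> J1" for j
    using E_iff[OF F0 G(1)[OF that], of j] G(2)[OF that] B(2) by blast+
  obtain L where L: "L \<subseteq> J1" "infinite L"
    "\<And>j. j \<in> L \<Longrightarrow> 2 * card (L \<inter> {..<j}) \<le> card (J1 \<inter> {..<j})"
    using infinite_subset_half_rank[OF \<open>infinite J1\<close>] by metis
  define H where "H j = (if j \<in> L then G j else {})" for j
  have suppH: "{j. H j \<noteq> {}} = L" unfolding H_def using GE(3) L(1) by auto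
  have "block_condition a I H"
    unfolding block_condition_def suppH
  proof (intro conjI allI impI)
    show "H j \<subseteq> I j" for j
      using GE(2)[of j] FI[OF F0, of j] L(1) unfolding H_def by auto
    show "infinite L" by fact
    fix j assume "H j \<noteq> {}"
    then have j: "j \<in> L" "j \<in> J1" "H j = G j" using L(1) unfolding H_def by (auto split: if_splits)
    have "card (J1 \<inter> {..<j}) \<le> r j"
      unfolding r_def using GE(1) by (intro card_mono) auto
    then have "card (L \<inter> {..<j}) \<le> r j div 2" using L(3)[OF j(1)] by linarith
    then have "(2::real) ^ (j * card (L \<inter> {..<j})) \<le> 2 ^ (j * (r j div 2))"
      by (intro power_increasing mult_le_mono2) auto
    also note GE(4)[OF j(2)]
    finally show "2 ^ (j * card (L \<inter> {..<j})) \<le> sum a (H j)" unfolding j(3) .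
  qed
  moreover have "block_le H F" if F: "F \<in> K" for F
  proof -
    \<comment> \<open>Distinct blocks where \<open>H j\<close> leaves \<open>F j\<close> give
      distinct codes in the finite set \<open>B - E F\<close>.\<close>
    have "(\<lambda>j. code j (G j)) ` {j. \<not> H j \<subseteq> F j} \<subseteq> B - E F"
    proof
      fix e assume "e \<in> (\<lambda>j. code j (G j)) ` {j. \<not> H j \<subseteq> F j}"
      then obtain j where j: "e = code j (G j)" "\<not> H j \<subseteq> F j" by blast
      then have "j \<in> J1" "\<not> G j \<subseteq> F j" using L(1) unfolding H_def by (auto split: if_splits)
      then show "e \<in> B - E F" using G E_iff[OF F, of "G j" j] unfolding j(1) by simp
    qed
    then have "finite ((\<lambda>j. code j (G j)) ` {j. \<not> H j \<subseteq> F j})" using BE[OF F] finite_subset by blast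
    moreover have "inj_on (\<lambda>j. code j (G j)) {j. \<not> H j \<subseteq> F j}" using code_fst by (intro inj_onI)
    ultimately show ?thesis unfolding block_le_def by (rule finite_imageD)
  qed
  ultimately show ?thesis by blast
qed

subsection \<open>N sets\<close>

lemma weighted_pigeonhole:
  fixes a :: "'a \<Rightarrow> real"
  assumes S: "finite S" and T: "finite T" "T \<noteq> {}" "g ` S \<subseteq> T"
  shows "\<exists>c\<in>T. sum a S \<le> card T * sum a {n \<in> S. g n = c}"
proof (rule ccontr)
  assume "\<not> ?thesis"
  then have less: "card T * sum a {n \<in> S. g n = c} < sum a S" if "c \<in> T" for c
    using that by (meson not_le)
  have "(\<Sum>c\<in>T. card T * sum a {n \<in> S. g n = c}) < (\<Sum>c\<in>T. sum a S)"
    using T(1,2) less by (rule sum_strict_mono)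
  moreover have "(\<Sum>c\<in>T. card T * sum a {n \<in> S. g n = c}) = card T * sum a S"
    using sum.group[OF S T(1,3), of a] by (simp flip: sum_distrib_left)
  ultimately show False by simp
qed

text \<open>Equal floors put both fractional parts into the same arc of length
  \<open>1 / 2 ^ j\<close>; by periodicity only their difference enters the sine.\<close>

lemma abs_sin_le_of_same_floor:
  assumes "\<lfloor>2 ^ j * frac (real n * x)\<rfloor> = \<lfloor>2 ^ j * frac (real m * x)\<rfloor>"
  shows "\<bar>sin (pi * ((real n - real m) * x))\<bar> \<le> pi / 2 ^ j"
proof -
  define d where "d = frac (real n * x) - frac (real m * x)"
  have "\<bar>2 ^ j * frac (real n * x) - 2 ^ j * frac (real m * x)\<bar> < 1"
    using assms by linarith
  then have "\<bar>2 ^ j * d\<bar> < 1" unfolding d_def by (simp add: right_diff_distrib)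
  then have d: "\<bar>d\<bar> < 1 / 2 ^ j" by (simp add: abs_mult field_simps)
  have "(real n - real m) * x = d + of_int (\<lfloor>real n * x\<rfloor> - \<lfloor>real m * x\<rfloor>)"
    unfolding d_def frac_def by (simp add: algebra_simps)
  then have "\<bar>sin (pi * ((real n - real m) * x))\<bar> = \<bar>sin (pi * d)\<bar>"
    by (simp only: abs_sin_pi_add_of_int)
  also have "\<dots> \<le> pi * \<bar>d\<bar>" using abs_sin_x_le_abs_x[of "pi * d"] by (simp add: abs_mult)
  also have "\<dots> \<le> pi * (1 / 2 ^ j)" using d by (intro mult_left_mono) auto
  finally show ?thesis by simp
qed

lemma block_condition_refine:
  assumes fin: "\<And>j. finite (I j)" and F: "block_condition a I F"
  obtains G where "block_condition a I G" "block_le G F"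
    "\<And>j n m. n \<in> G j \<Longrightarrow> m \<in> G j \<Longrightarrow> \<bar>sin (pi * ((real n - real m) * x))\<bar> \<le> pi / 2 ^ j"
proof -
  define J where "J = {j. F j \<noteq> {}}"
  have FI: "F j \<subseteq> I j" and J: "infinite J"
    and wt: "j \<in> J \<Longrightarrow> 2 ^ (j * card (J \<inter> {..<j})) \<le> sum a (F j)" for j
    using F unfolding block_condition_def J_def by auto
  define g where "g j n = \<lfloor>2 ^ j * frac (real n * x)\<rfloor>" for j n
  have "\<exists>c. sum a (F j) \<le> 2 ^ j * sum a {n \<in> F j. g j n = c}" for j
  proof -
    have "g j n \<in> {0..<2 ^ j}" for n
    proof -
      have "2 ^ j * frac (real n * x) < 2 ^ j * 1"
        using frac_lt_1 by (intro mult_strict_left_mono) auto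
      then show ?thesis unfolding g_def by (simp add: floor_less_iff)
    qed
    then have "g j ` F j \<subseteq> {0..<2 ^ j}" by blast
    from weighted_pigeonhole[OF finite_subset[OF FI fin] _ _ this, of a]
    show ?thesis by auto
  qed
  then obtain c where c: "\<And>j. sum a (F j) \<le> 2 ^ j * sum a {n \<in> F j. g j n = c j}"
    by metis
  \<comment> \<open>Removing the first nonempty block lowers the rank of every remaining block by
    one, compensating the pigeonhole loss everywhere at once.\<close>
  define j0 where "j0 = (LEAST j. j \<in> J)"
  have "J \<noteq> {}" using J by auto
  then have j0: "j0 \<in> J" "\<And>j. j \<in> J \<Longrightarrow> j0 \<le> j"
    unfolding j0_def by (auto intro: LeastI Least_le)
  define G where "G j = (if j = j0 then {} else {n \<in> F j. g j n = c j})" for j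
  have pos: "0 < sum a (F j)" if "j \<in> J" for j
    using wt[OF that] by (rule less_le_trans[rotated]) simp
  have GF: "G j \<subseteq> F j" for j unfolding G_def by auto
  have ne: "G j \<noteq> {}" if "j \<in> J" "j \<noteq> j0" for j
  proof
    assume "G j = {}"
    then have "{n \<in> F j. g j n = c j} = {}" using that(2) unfolding G_def by simp
    then show False using c[of j] pos[OF that(1)] by (simp only: sum.empty)
  qed
  have supp: "{j. G j \<noteq> {}} = J - {j0}"
    using ne GF unfolding G_def J_def by auto
  have "block_condition a I G"
    unfolding block_condition_def supp
  proof (intro conjI allI impI)
    show "G j \<subseteq> I j" for j using GF FI by blast
    show "infinite (J - {j0})" using J by simp
    fix j assume "G j \<noteq> {}"
    then have j: "j \<in> J" "j \<noteq> j0" using supp by auto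
    then have "j0 < j" using j0(2) by (simp add: le_neq_implies_less)
    then have "J \<inter> {..<j} = insert j0 ((J - {j0}) \<inter> {..<j})" using j0(1) by auto
    then have "card (J \<inter> {..<j}) = Suc (card ((J - {j0}) \<inter> {..<j}))" by simp
    then have "2 ^ j * 2 ^ (j * card ((J - {j0}) \<inter> {..<j})) = (2::real) ^ (j * card (J \<inter> {..<j}))"
      by (simp add: power_add)
    also have "\<dots> \<le> 2 ^ j * sum a (G j)" using wt[OF j(1)] c[of j] j(2) unfolding G_def by simp
    finally show "2 ^ (j * card ((J - {j0}) \<inter> {..<j})) \<le> sum a (G j)" by simp
  qed
  moreover have "block_le G F" using GF by (simp add: block_le_def)
  moreover have "\<bar>sin (pi * ((real n - real m) * x))\<bar> \<le> pi / 2 ^ j" if "n \<in> G j" "m \<in> G j" for j n m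
    using that unfolding G_def g_def by (intro abs_sin_le_of_same_floor) (simp split: if_splits)
  ultimately show ?thesis by (rule that)
qed

text \<open>Each \<open>w i\<close> is a finite measure on frequencies; the hypothesis \<open>i \<le> k p\<close> makes every frequency
  receive weight from finitely many of them only.\<close>

lemma N_set_if_finite_measures:
  fixes T :: "nat \<Rightarrow> 'p set" and w :: "nat \<Rightarrow> 'p \<Rightarrow> real" and k :: "'p \<Rightarrow> nat"
  assumes fin: "\<And>i. finite (T i)" and nn: "\<And>i p. p \<in> T i \<Longrightarrow> 0 \<le> w i p"
    and large: "\<And>i p. p \<in> T i \<Longrightarrow> i \<le> k p" and total: "\<And>i. 1 / 2 \<le> sum (w i) (T i)"
    and sm: "\<And>x. x \<in> S \<Longrightarrow> summable (\<lambda>i. \<Sum>p\<in>T i. w i p * \<bar>sin (pi * real (k p) * x)\<bar>)"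
  shows "N_set S"
proof -
  \<comment> \<open>Stopping at \<open>i = n\<close> loses no weight: by \<open>large\<close>, a
    frequency \<open>n\<close> cannot occur in \<open>T i\<close> with \<open>i > n\<close>.\<close>
  define b where "b n = (\<Sum>i\<le>n. \<Sum>p\<in>{p \<in> T i. k p = n}. w i p)" for n
  have bnn: "0 \<le> b n" for n unfolding b_def using nn by (intro sum_nonneg) auto
  have b_sum: "(\<Sum>n<N. b n * g n) = (\<Sum>i<N. \<Sum>p\<in>{p \<in> T i. k p < N}. w i p * g (k p))" for g N
  proof -
    have "b n * g n = (\<Sum>i<N. \<Sum>p\<in>{p \<in> T i. k p = n}. w i p * g (k p))" if "n < N" for n
    proof -
      have "(\<Sum>p\<in>{p \<in> T i. k p = n}. w i p * g (k p)) = 0" if "n < i" for i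
        using large[of _ i] that by (intro sum.neutral) force
      then have "(\<Sum>i<N. \<Sum>p\<in>{p \<in> T i. k p = n}. w i p * g (k p))
          = (\<Sum>i\<le>n. \<Sum>p\<in>{p \<in> T i. k p = n}. w i p * g (k p))"
        using that by (intro sum.mono_neutral_right) auto
      also have "\<dots> = b n * g n" unfolding b_def sum_distrib_right by (intro sum.cong) auto
      finally show ?thesis by simp
    qed
    then have "(\<Sum>n<N. b n * g n) = (\<Sum>n<N. \<Sum>i<N. \<Sum>p\<in>{p \<in> T i. k p = n}. w i p * g (k p))"
      by (intro sum.cong) auto
    also have "\<dots> = (\<Sum>i<N. \<Sum>n<N. \<Sum>p\<in>{p \<in> T i. k p = n}. w i p * g (k p))"
      by (rule sum.swap)
    also have "\<dots> = (\<Sum>i<N. \<Sum>p\<in>{p \<in> T i. k p < N}. w i p * g (k p))"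
    proof (intro sum.cong refl)
      fix i
      have "(\<Sum>n<N. \<Sum>p\<in>{p \<in> T i. k p = n}. w i p * g (k p))
          = (\<Sum>n<N. \<Sum>p\<in>{p \<in> {p \<in> T i. k p < N}. k p = n}. w i p * g (k p))"
        by (intro sum.cong) auto
      also have "\<dots> = (\<Sum>p\<in>{p \<in> T i. k p < N}. w i p * g (k p))"
        using fin by (intro sum.group) auto
      finally show "(\<Sum>n<N. \<Sum>p\<in>{p \<in> T i. k p = n}. w i p * g (k p))
          = (\<Sum>p\<in>{p \<in> T i. k p < N}. w i p * g (k p))" .
    qed
    finally show ?thesis .
  qed
  have "filterlim (\<lambda>N. \<Sum>n<N. b n) at_top sequentially"
    unfolding filterlim_at_top
  proof
    fix Z :: real
    obtain Q :: nat where Q: "2 * Z \<le> real Q" using real_arch_simple by blast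
    \<comment> \<open>The first \<open>Q\<close> measures live on finitely many frequencies, all
      below some \<open>N1\<close>. Each has mass at least \<open>1 / 2\<close>, so together they
      reach \<open>Z\<close>.\<close>
    have "finite (\<Union>i<Q. k ` T i)" using fin by blast
    then obtain N1 where N1: "(\<Union>i<Q. k ` T i) \<subseteq> {..<N1}" using finite_nat_bounded by metis
    have "Z \<le> (\<Sum>n<N. b n)" if N: "N \<ge> max Q N1" for N
    proof -
      have "Z \<le> (\<Sum>i<Q. 1 / 2)" using Q by simp
      also have "\<dots> \<le> (\<Sum>i<Q. sum (w i) (T i))" using total by (intro sum_mono)
      also have "\<dots> = (\<Sum>i<Q. \<Sum>p\<in>{p \<in> T i. k p < N}. w i p)"
      proof (intro sum.cong refl)
        fix i assume "i \<in> {..<Q}"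
        then have "k p < N" if "p \<in> T i" for p using N1 N that by fastforce
        then show "T i = {p \<in> T i. k p < N}" by blast
      qed
      also have "\<dots> \<le> (\<Sum>i<N. \<Sum>p\<in>{p \<in> T i. k p < N}. w i p)"
        using N nn by (intro sum_mono2 sum_nonneg) auto
      also have "\<dots> = (\<Sum>n<N. b n)" using b_sum[of "\<lambda>_. 1" N] by simp
      finally show ?thesis .
    qed
    then show "\<forall>\<^sub>F N in sequentially. Z \<le> (\<Sum>n<N. b n)"
      unfolding eventually_sequentially by blast
  qed
  moreover have "summable (\<lambda>n. \<bar>b n * sin (pi * real n * x)\<bar>)" if x: "x \<in> S" for x
  proof (rule summableI_nonneg_bounded)
    fix N
    let ?v = "\<lambda>i p. w i p * \<bar>sin (pi * real (k p) * x)\<bar>"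
    have "(\<Sum>n<N. \<bar>b n * sin (pi * real n * x)\<bar>) = (\<Sum>n<N. b n * \<bar>sin (pi * real n * x)\<bar>)"
      using bnn by (simp add: abs_mult)
    also have "\<dots> = (\<Sum>i<N. \<Sum>p\<in>{p \<in> T i. k p < N}. ?v i p)" by (rule b_sum)
    also have "\<dots> \<le> (\<Sum>i<N. sum (?v i) (T i))"
      using fin nn by (intro sum_mono sum_mono2) auto
    also have "\<dots> \<le> (\<Sum>i. sum (?v i) (T i))"
      using nn by (intro sum_le_suminf sm[OF x] sum_nonneg) auto
    finally show "(\<Sum>n<N. \<bar>b n * sin (pi * real n * x)\<bar>) \<le> (\<Sum>i. sum (?v i) (T i))" .
  qed simp
  ultimately show ?thesis unfolding N_set_def by (intro exI[of _ b]) auto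
qed

section \<open>Normalized weights and differences of frequencies\<close>

lemma summable_block_sums:
  fixes g :: "nat \<Rightarrow> real"
  assumes g: "\<And>n. 0 \<le> g n" "summable g" and M: "strict_mono M"
  shows "summable (\<lambda>j. sum g {M j..<M (Suc j)})"
proof (rule summableI_nonneg_bounded)
  fix n
  have "(\<Sum>j<n. sum g {M j..<M (Suc j)}) = sum g {M 0..<M n}"
  proof (induction n)
    case (Suc n)
    then show ?case
      using sum.atLeastLessThan_concat[of "M 0" "M n" "M (Suc n)" g] M by (simp add: strict_mono_less_eq)
  qed simp
  also have "\<dots> \<le> suminf g" using g by (intro sum_le_suminf) auto
  finally show "(\<Sum>j<n. sum g {M j..<M (Suc j)}) \<le> suminf g" .
qed (use g in \<open>auto intro: sum_nonneg\<close>)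

text \<open>With no empty block, block \<open>j\<close> has rank \<open>j\<close>, so
  \<open>2 ^ (j * j)\<close> is exactly the weight that \<open>block_condition\<close> demands. The
  cap at 1 allows near pairs of frequencies to be estimated by counting.\<close>

lemma N_set_normalized:
  assumes "N_set A"
  obtains a :: "nat \<Rightarrow> real" and M :: "nat \<Rightarrow> nat" where "\<And>n. 0 \<le> a n" "\<And>n. a n \<le> 1"
    "strict_mono M" "\<And>j. 2 ^ (j * j) \<le> sum a {M j..<M (Suc j)}"
    "\<And>x. x \<in> A \<Longrightarrow> summable (\<lambda>n. a n * \<bar>sin (pi * real n * x)\<bar>)"
proof -
  obtain u :: "nat \<Rightarrow> real" where u: "filterlim (\<lambda>N. \<Sum>n<N. u n) at_top sequentially"
    and s: "\<And>x. x \<in> A \<Longrightarrow> summable (\<lambda>n. \<bar>u n * sin (pi * real n * x)\<bar>)"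
    using assms by (auto simp: N_set_def)
  define a where "a n = min 1 \<bar>u n\<bar>" for n
  have a: "0 \<le> a n" "a n \<le> 1" "a n \<le> \<bar>u n\<bar>" for n unfolding a_def by auto
  have nsum: "\<not> summable a"
  proof
    \<comment> \<open>Summable capped weights tend to 0, so the cap acts only finitely often and
      \<open>u\<close> itself would be summable.\<close>
    assume sa: "summable a"
    then have "\<forall>\<^sub>F n in sequentially. a n < 1"
      using order_tendstoD(2)[OF summable_LIMSEQ_zero[OF sa], of 1] by simp
    then have "\<forall>\<^sub>F n in sequentially. a n = \<bar>u n\<bar>"
      by eventually_elim (auto simp: a_def)
    then have "summable (\<lambda>n. \<bar>u n\<bar>)" using sa summable_cong by fast
    then have "summable u" by (rule summable_rabs_cancel)
    then have "(\<lambda>N. \<Sum>n<N. u n) \<longlonglongrightarrow> suminf u" by (rule summable_LIMSEQ)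
    moreover have "filterlim (\<lambda>N. \<Sum>n<N. u n) at_infinity sequentially"
      using u by (rule filterlim_at_top_imp_at_infinity)
    ultimately show False using not_tendsto_and_filterlim_at_infinity[of sequentially] by auto
  qed
  have step: "\<exists>m'. True \<and> m < m' \<and> 2 ^ (j * j) \<le> sum a {m..<m'}" for m j
  proof (rule ccontr)
    assume contra: "\<not> ?thesis"
    have "sum a {..<n} \<le> sum a {..<m} + 2 ^ (j * j)" for n
    proof -
      have "sum a {..<n} \<le> sum a {..<max n (Suc m)}" using a(1) by (intro sum_mono2) auto
      also have "\<dots> = sum a {..<m} + sum a {m..<max n (Suc m)}"
        using sum.atLeastLessThan_concat[of 0 m "max n (Suc m)" a] by (simp add: lessThan_atLeast0)
      also have "\<dots> \<le> sum a {..<m} + 2 ^ (j * j)"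
      proof -
        have "m < max n (Suc m)" by simp
        then have "\<not> 2 ^ (j * j) \<le> sum a {m..<max n (Suc m)}" using contra by blast
        then show ?thesis by linarith
      qed
      finally show ?thesis .
    qed
    then have "summable a" using a(1) by (intro summableI_nonneg_bounded)
    with nsum show False by contradiction
  qed
  obtain M :: "nat \<Rightarrow> nat" where M: "\<And>j. M j < M (Suc j)" "\<And>j. 2 ^ (j * j) \<le> sum a {M j..<M (Suc j)}"
    using dependent_nat_choice[of "\<lambda>_ _. True" "\<lambda>j m m'. m < m' \<and> 2 ^ (j * j) \<le> sum a {m..<m'}"] step
    by blast
  have "summable (\<lambda>n. a n * \<bar>sin (pi * real n * x)\<bar>)" if "x \<in> A" for x
  proof (rule summable_comparison_test'[OF s[OF that]])
    show "norm (a n * \<bar>sin (pi * real n * x)\<bar>) \<le> \<bar>u n * sin (pi * real n * x)\<bar>" for n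
      using mult_right_mono[OF a(3)[of n], of "\<bar>sin (pi * real n * x)\<bar>"] a(1)[of n]
      by (simp add: abs_mult)
  qed
  moreover have "strict_mono M" using M(1) by (simp add: strict_mono_Suc_iff)
  ultimately show ?thesis using that a(1,2) M(2) by blast
qed

lemma sum_pairs_product:
  fixes f g :: "'a \<Rightarrow> real"
  shows "(\<Sum>p\<in>S \<times> S. f (fst p) * g (snd p)) = sum f S * sum g S"
  by (simp add: sum_product sum.cartesian_product split_def)

text \<open>Each \<open>n\<close> has at most \<open>2 * t\<close> partners at distance below
  \<open>t\<close>, of weight at most 1 each. Near pairs thus weigh at most
  \<open>2 * t * sum a S\<close>, which is at most half of the total
  \<open>(sum a S)\<^sup>2\<close>.\<close>

lemma sum_far_pairs_ge:
  fixes a :: "nat \<Rightarrow> real"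
  assumes S: "finite S" and a: "\<And>n. 0 \<le> a n" "\<And>n. a n \<le> 1"
    and t: "4 * real t \<le> sum a S"
  shows "(sum a S)\<^sup>2 / 2
    \<le> (\<Sum>p\<in>{p \<in> S \<times> S. t \<le> nat \<bar>int (fst p) - int (snd p)\<bar>}. a (fst p) * a (snd p))"
proof -
  let ?far = "{p \<in> S \<times> S. t \<le> nat \<bar>int (fst p) - int (snd p)\<bar>}"
  let ?near = "{p \<in> S \<times> S. \<not> t \<le> nat \<bar>int (fst p) - int (snd p)\<bar>}"
  let ?w = "\<lambda>p. a (fst p) * a (snd p)"
  have "?near \<subseteq> (SIGMA n:S. {n - t..<n + t})" by auto
  then have "sum ?w ?near \<le> sum ?w (SIGMA n:S. {n - t..<n + t})"
    using S a(1) by (intro sum_mono2 finite_SigmaI) auto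
  also have "\<dots> = (\<Sum>n\<in>S. \<Sum>m\<in>{n - t..<n + t}. a n * a m)"
    using S by (subst sum.Sigma) (auto simp: split_def)
  also have "\<dots> \<le> (\<Sum>n\<in>S. a n * (2 * real t))"
  proof (rule sum_mono)
    fix n
    have "(\<Sum>m\<in>{n - t..<n + t}. a n * a m) \<le> (\<Sum>m\<in>{n - t..<n + t}. a n)"
      using a by (intro sum_mono mult_left_le)
    also have "\<dots> = a n * real (card {n - t..<n + t})" by simp
    also have "\<dots> \<le> a n * (2 * real t)" using a(1) by (intro mult_left_mono) auto
    finally show "(\<Sum>m\<in>{n - t..<n + t}. a n * a m) \<le> a n * (2 * real t)" .
  qed
  also have "\<dots> = sum a S * (2 * real t)" by (simp add: sum_distrib_right)
  also have "\<dots> \<le> sum a S * (sum a S / 2)"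
    using t a(1) by (intro mult_left_mono sum_nonneg) auto
  finally have near: "sum ?w ?near \<le> (sum a S)\<^sup>2 / 2" by (simp add: power2_eq_square)
  have "S \<times> S = ?far \<union> ?near" by blast
  then have "(sum a S)\<^sup>2 = sum ?w (?far \<union> ?near)"
    using sum_pairs_product[of a a S] by (simp add: power2_eq_square)
  also have "\<dots> = sum ?w ?far + sum ?w ?near" using S by (intro sum.union_disjoint) auto
  finally show ?thesis using near by (simp add: field_simps)
qed

lemma N_set_Un:
  assumes A: "N_set A" and X: "|X| <o cardinal_t"
  shows "N_set (A \<union> X)"
proof -
  obtain a :: "nat \<Rightarrow> real" and M :: "nat \<Rightarrow> nat"
    where a: "\<And>n. 0 \<le> a n" "\<And>n. a n \<le> 1" and M: "strict_mono M"
    and big: "\<And>j. 2 ^ (j * j) \<le> sum a {M j..<M (Suc j)}"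
    and smA: "\<And>x. x \<in> A \<Longrightarrow> summable (\<lambda>n. a n * \<bar>sin (pi * real n * x)\<bar>)"
    by (rule N_set_normalized[OF A]) blast
  define I where "I j = {M j..<M (Suc j)}" for j
  have finI: "finite (I j)" for j unfolding I_def by simp
  have neI: "I j \<noteq> {}" for j using strict_mono_less[OF M, of j "Suc j"] unfolding I_def by simp
  have top: "block_condition a I I"
    unfolding block_condition_def using neI big by (simp add: I_def)
  \<comment> \<open>Requiring near-constancy only from some \<open>j0\<close> on makes
    \<open>D x\<close> pass to \<open>block_le\<close>-smaller conditions, which may differ on
    finitely many blocks.\<close>
  define D where "D x F \<longleftrightarrow> (\<exists>j0. \<forall>j\<ge>j0. \<forall>n\<in>F j. \<forall>m\<in>F j.
      \<bar>sin (pi * ((real n - real m) * x))\<bar> \<le> pi / 2 ^ j)" for x and F :: "nat \<Rightarrow> nat set"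
  obtain F where F: "block_condition a I F" and DF: "\<And>x. x \<in> X \<Longrightarrow> D x F"
  proof (rule transfinite_fusion[of block_le "Collect (block_condition a I)" X D])
    show "block_le F F" for F by (rule block_le_refl)
    show "block_le F H" if "block_le F G" "block_le G H" for F G H using that by (rule block_le_trans)
    show "\<exists>H\<in>Collect (block_condition a I). \<forall>F\<in>K. block_le H F"
      if "K \<subseteq> Collect (block_condition a I)" "\<And>F G. F \<in> K \<Longrightarrow> G \<in> K \<Longrightarrow> block_le F G \<or> block_le G F"
        "|K| \<le>o |X|" for K
      using block_chain_lower_bound[of I a K, OF finI top _ that(2) ordLeq_ordLess_trans[OF that(3) X]] that(1)
      by blast
    show "\<exists>G\<in>Collect (block_condition a I). block_le G F \<and> D x G"
      if FP: "F \<in> Collect (block_condition a I)" for x F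
    proof -
      obtain G where G: "block_condition a I G" "block_le G F"
        "\<And>j n m. n \<in> G j \<Longrightarrow> m \<in> G j \<Longrightarrow> \<bar>sin (pi * ((real n - real m) * x))\<bar> \<le> pi / 2 ^ j"
        using block_condition_refine[of I a F x, OF finI] FP by auto
      then have "D x G" unfolding D_def by blast
      with G show ?thesis by blast
    qed
    show "D x G" if DxF: "D x F" and le: "block_le G F" for x F G
    proof -
      obtain j0 where j0: "\<And>j n m. j \<ge> j0 \<Longrightarrow> n \<in> F j \<Longrightarrow> m \<in> F j \<Longrightarrow>
          \<bar>sin (pi * ((real n - real m) * x))\<bar> \<le> pi / 2 ^ j"
        using DxF unfolding D_def by blast
      obtain j1 where j1: "{j. \<not> G j \<subseteq> F j} \<subseteq> {..<j1}"
        using finite_nat_bounded le unfolding block_le_def by metis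
      have "G j \<subseteq> F j" if "j \<ge> j1" for j using j1 that by fastforce
      then have "\<forall>j\<ge>max j0 j1. \<forall>n\<in>G j. \<forall>m\<in>G j. \<bar>sin (pi * ((real n - real m) * x))\<bar> \<le> pi / 2 ^ j"
        using j0 by (simp add: subset_iff)
      then show ?thesis unfolding D_def by blast
    qed
  qed auto
  define J where "J = {j. F j \<noteq> {}}"
  have FI: "F j \<subseteq> I j" and J: "infinite J"
    and wt: "j \<in> J \<Longrightarrow> 2 ^ (j * card (J \<inter> {..<j})) \<le> sum a (F j)" for j
    using F unfolding block_condition_def J_def by auto
  obtain N where N: "\<And>j. j \<ge> N \<Longrightarrow> 2 \<le> card (J \<inter> {..<j})"
    using infinite_rank_unbounded[OF J] by metis
  \<comment> \<open>The shift by \<open>N\<close> leaves blocks of rank at least 2, whose weight is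
    at least \<open>2 ^ (t i * 2) = 4 ^ t i\<close>. This dominates \<open>4 * t i\<close>, as
    \<open>sum_far_pairs_ge\<close> requires.\<close>
  define t where "t i = enumerate J (i + N)" for i
  have t: "strict_mono t" "\<And>i. t i \<in> J" "\<And>i. i + N \<le> t i"
    using J strict_mono_enumerate[OF J] enumerate_in_set[OF J] le_enumerate[OF J] unfolding t_def
    by (auto simp: strict_mono_def)
  have it: "i \<le> t i" for i using t(3)[of i] by simp
  define S where "S i = F (t i)" for i
  define W where "W i = sum a (S i)" for i
  have finS: "finite (S i)" for i unfolding S_def using FI finI by (rule finite_subset)
  have W4: "4 ^ t i \<le> W i" for i
  proof -
    have "(4::real) ^ t i = 2 ^ (t i * 2)" by (simp add: power_mult[of 2 2] mult.commute[of "t i" 2])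
    also have "\<dots> \<le> 2 ^ (t i * card (J \<inter> {..<t i}))"
      using N[of "t i"] t(3)[of i] by (intro power_increasing mult_le_mono2) auto
    also have "\<dots> \<le> W i" using wt[OF t(2)] unfolding W_def S_def .
    finally show ?thesis .
  qed
  have W1: "1 \<le> W i" for i using W4[of i] one_le_power[of "4::real" "t i"] by linarith
  have Wt: "4 * real (t i) \<le> W i" for i
  proof -
    have "4 * n \<le> 4 ^ n" for n :: nat
    proof (induction n)
      case (Suc n)
      show ?case
      proof (cases n)
        case (Suc m)
        then have "(4::nat) \<le> 4 ^ n" by simp
        with Suc.IH show ?thesis by simp
      qed simp
    qed simp
    from this[of "t i"] have "4 * real (t i) \<le> 4 ^ t i"
      by (metis of_nat_le_iff of_nat_mult of_nat_numeral of_nat_power)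
    with W4[of i] show ?thesis by linarith
  qed
  define k where "k p = nat \<bar>int (fst p) - int (snd p)\<bar>" for p :: "nat \<times> nat"
  \<comment> \<open>Discarding pairs closer than \<open>t i\<close> pushes the difference
    frequencies to infinity with \<open>i\<close>, yet keeps at least half of the mass.\<close>
  define T where "T i = {p \<in> S i \<times> S i. t i \<le> k p}" for i
  \<comment> \<open>On differences of two independent frequencies drawn from \<open>S i\<close> the averages are small at points of
    \<open>X\<close> by near-constancy on \<open>S i\<close>, and at points of \<open>A\<close> by the triangle inequality.\<close>
  define w where "w i p = a (fst p) * a (snd p) / (W i)\<^sup>2" for i p
  have wnn: "0 \<le> w i p" for i p unfolding w_def using a(1) by simp
  have k_sin: "\<bar>sin (pi * real (k p) * x)\<bar> = \<bar>sin (pi * ((real (fst p) - real (snd p)) * x))\<bar>" for p x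
  proof -
    define d where "d = real (fst p) - real (snd p)"
    have "real (k p) = \<bar>d\<bar>" unfolding k_def d_def by simp
    then have "pi * real (k p) * x = pi * (d * x) \<or> pi * real (k p) * x = - (pi * (d * x))"
      by (simp add: abs_real_def)
    then show ?thesis unfolding d_def[symmetric] by (metis abs_minus_cancel sin_minus)
  qed
  have w_total: "sum (w i) (S i \<times> S i) = 1" for i
  proof -
    have "sum (w i) (S i \<times> S i) = W i * W i / (W i)\<^sup>2"
      unfolding w_def by (simp add: sum_pairs_product W_def flip: sum_divide_distrib)
    then show ?thesis using W1[of i] by (simp add: power2_eq_square)
  qed
  show ?thesis
  proof (rule N_set_if_finite_measures[of T w k])
    show "finite (T i)" for i unfolding T_def using finS by simp
    show "0 \<le> w i p" for i p by (rule wnn)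
    show "i \<le> k p" if "p \<in> T i" for i p using that it[of i] unfolding T_def by simp
    show "1 / 2 \<le> sum (w i) (T i)" for i
    proof -
      have "(W i)\<^sup>2 / 2 \<le> (\<Sum>p\<in>T i. a (fst p) * a (snd p))"
        using sum_far_pairs_ge[OF finS a Wt[unfolded W_def]] unfolding T_def k_def W_def .
      then have "(W i)\<^sup>2 / 2 / (W i)\<^sup>2 \<le> sum (w i) (T i)"
        unfolding w_def sum_divide_distrib[symmetric] by (rule divide_right_mono) simp
      then show ?thesis using W1[of i] by simp
    qed
    fix x assume x: "x \<in> A \<union> X"
    let ?v = "\<lambda>i. \<Sum>p\<in>T i. w i p * \<bar>sin (pi * real (k p) * x)\<bar>"
    have vnn: "0 \<le> ?v i" for i using wnn by (intro sum_nonneg) auto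
    show "summable ?v"
    proof (cases "x \<in> A")
      case True
      define s where "s n = \<bar>sin (pi * real n * x)\<bar>" for n
      define u where "u j = (\<Sum>n\<in>I j. a n * s n)" for j
      have snn: "0 \<le> s n" for n unfolding s_def by simp
      have "summable u"
        unfolding u_def I_def using a(1) snn smA[OF True] M
        by (intro summable_block_sums) (simp_all add: s_def)
      then have "summable (u \<circ> t)"
        using a(1) snn t(1) unfolding u_def
        by (intro summable_reindex sum_nonneg strict_mono_imp_inj_on) auto
      then have "summable (\<lambda>i. 2 * u (t i))" by (intro summable_mult) (simp add: o_def)
      then show ?thesis
      proof (rule summable_comparison_test')
        fix i
        have "?v i \<le> (\<Sum>p\<in>T i. w i p * (s (fst p) + s (snd p)))"
        proof (intro sum_mono mult_left_mono wnn)
          fix p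
          have "pi * ((real (fst p) - real (snd p)) * x) = pi * real (fst p) * x - pi * real (snd p) * x"
            by (simp add: algebra_simps)
          then show "\<bar>sin (pi * real (k p) * x)\<bar> \<le> s (fst p) + s (snd p)"
            unfolding k_sin s_def by (simp only: abs_sin_diff_le)
        qed
        also have "\<dots> \<le> (\<Sum>p\<in>S i \<times> S i. w i p * (s (fst p) + s (snd p)))"
          using finS wnn snn unfolding T_def by (intro sum_mono2 mult_nonneg_nonneg add_nonneg_nonneg) auto
        also have "\<dots> = (\<Sum>p\<in>S i \<times> S i. (a (fst p) * s (fst p)) * a (snd p) / (W i)\<^sup>2
            + a (fst p) * (a (snd p) * s (snd p)) / (W i)\<^sup>2)"
          unfolding w_def by (intro sum.cong refl) (simp add: algebra_simps add_divide_distrib)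
        \<comment> \<open>In each product the coordinate without \<open>s\<close> sums to
          \<open>W i\<close>. The remaining division by \<open>W i \<ge> 1\<close> leaves a bound by
          a block sum of the original series.\<close>
        also have "\<dots> = 2 * ((\<Sum>n\<in>S i. a n * s n) * W i / (W i)\<^sup>2)"
          unfolding sum.distrib sum_divide_distrib[symmetric] W_def
          using sum_pairs_product[of "\<lambda>n. a n * s n" a "S i"] sum_pairs_product[of a "\<lambda>n. a n * s n" "S i"]
          by simp
        also have "\<dots> = 2 * ((\<Sum>n\<in>S i. a n * s n) / W i)"
          using W1[of i] by (simp add: power2_eq_square)
        also have "\<dots> \<le> 2 * (\<Sum>n\<in>S i. a n * s n)"
        proof -
          have "0 \<le> (\<Sum>n\<in>S i. a n * s n)" using a(1) snn by (intro sum_nonneg) auto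
          then have "(\<Sum>n\<in>S i. a n * s n) / W i \<le> (\<Sum>n\<in>S i. a n * s n) / 1"
            using W1[of i] by (intro divide_left_mono) auto
          then show ?thesis by simp
        qed
        also have "\<dots> \<le> 2 * u (t i)"
          unfolding u_def S_def using finI FI a(1) snn by (intro mult_left_mono sum_mono2) auto
        finally show "norm (?v i) \<le> 2 * u (t i)" using vnn[of i] by simp
      qed
    next
      case False
      with x have "x \<in> X" by simp
      then obtain j0 where j0: "\<And>j n m. j \<ge> j0 \<Longrightarrow> n \<in> F j \<Longrightarrow> m \<in> F j \<Longrightarrow>
          \<bar>sin (pi * ((real n - real m) * x))\<bar> \<le> pi / 2 ^ j"
        using DF unfolding D_def by blast
      have "summable (\<lambda>i. pi * (1 / 2) ^ i)" by (intro summable_mult summable_geometric) simp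
      then show ?thesis
      proof (rule summable_comparison_test')
        fix i assume i: "i \<ge> j0"
        have "?v i \<le> (\<Sum>p\<in>T i. w i p * (pi / 2 ^ t i))"
        proof (intro sum_mono mult_left_mono wnn)
          fix p assume "p \<in> T i"
          then show "\<bar>sin (pi * real (k p) * x)\<bar> \<le> pi / 2 ^ t i"
            unfolding k_sin T_def S_def using i it[of i] by (intro j0) auto
        qed
        also have "\<dots> = sum (w i) (T i) * (pi / 2 ^ t i)" by (rule sum_distrib_right[symmetric])
        also have "\<dots> \<le> 1 * (pi / 2 ^ t i)"
        proof (rule mult_right_mono)
          have "sum (w i) (T i) \<le> sum (w i) (S i \<times> S i)"
            using finS wnn unfolding T_def by (intro sum_mono2) auto
          then show "sum (w i) (T i) \<le> 1" using w_total by simp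
        qed simp
        also have "\<dots> \<le> pi / 2 ^ i"
          using it[of i] by (simp add: divide_left_mono power_increasing)
        finally show "norm (?v i) \<le> pi * (1 / 2) ^ i" using vnn[of i] by (simp add: power_divide)
      qed
    qed
  qed
qed

theorem theorem1:
  fixes A X :: "real set"
  shows "(N_set A \<and> |X| <o cardinal_t \<longrightarrow>
            N_set (A \<union> X) \<and> N_set {a + x | a x. a \<in> A \<and> x \<in> X}) \<and>
         (N0_set A \<and> |X| <o cardinal_h \<longrightarrow>
            N0_set (A \<union> X) \<and> N0_set {a + x | a x. a \<in> A \<and> x \<in> X}) \<and>
         (pseudo_Dirichlet_set A \<and> |X| <o cardinal_h \<longrightarrow>
            pseudo_Dirichlet_set (A \<union> X) \<and> pseudo_Dirichlet_set {a + x | a x. a \<in> A \<and> x \<in> X}) \<and>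
         (Arbault_set A \<and> |X| <o cardinal_s \<longrightarrow>
            Arbault_set (A \<union> X) \<and> Arbault_set {a + x | a x. a \<in> A \<and> x \<in> X}) \<and>
         (Hardy_sigma_set A \<and> |X| <o cardinal_s \<longrightarrow>
            Hardy_sigma_set (A \<union> X))"
  using N_set_Un N_set_sumset N0_set_Un N0_set_sumset pseudo_Dirichlet_set_Un
    pseudo_Dirichlet_set_sumset Arbault_set_Un Arbault_set_sumset Hardy_sigma_set_Un
  by (intro conjI impI; elim conjE) simp_all

end
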